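(* Let $m,n,k$ be positive integers with $k\le\min\{m,n\}$, $\lambda>0$, $A=[a_{i,j}]\in\mathbb{R}^{m\times n}$, and $W=[w_{i,j}]\in\mathbb{R}^{m\times n}$ with $w_{i,j}\ge0$ for all $i,j$ and $\sum_{i,j}w_{i,j}=1$. Let $a:=\max_{i,j}a_{i,j}^2$. Let $\kappa$ satisfy $0<\kappa<\frac{\lambda}{4k+2\lambda^2}$, let $$\rho_0=\frac{(1+16k\kappa)a}{4\lambda-16k\kappa-8\lambda^2\kappa},$$ where it is assumed that $\rho_0>0$, let $\alpha>0$, $0<\varepsilon\le\frac12$, and $\beta=\left(\frac{\alpha}{\kappa}\right)^{\frac{2}{1+2\varepsilon}}$. Let $(U_0,\mathbf{x}_0,V_0)\in V_k(\mathbb{R}^m)\times\mathbb{R}^k\times V_k(\mathbb{R}^n)$ be a fixed initial point and $$\rho_1=\max\{\|\mathbf{x}_0\|^2,\ \rho_0+a\kappa+(16ka+8\lambda^2\rho_0+16k\rho_0)\kappa^2\}.$$ Let $\{(\tau_t,\gamma_t)\}_{t\ge0}$ be independent random elements of $\Omega_{m,n}=\{1,\dots,m\}\times\{1,\dots,n\}$ with the common distribution $\mu(\{(i,j)\})=w_{i,j}$, and define, for $t\ge 0$, $$\eta_t=\frac{\alpha}{\bigl(\beta+\sum_{\iota=0}^{t-1}\|\nabla g_{\tau_\iota,\gamma_\iota}(U_\iota,\mathbf{x}_\iota,V_\iota)\|^2\bigr)^{\frac12+\varepsilon}},\qquad (U_{t+1},\mathbf{x}_{t+1},V_{t+1})=R_{(U_t,\mathbf{x}_t,V_t)}\bigl(-\eta_t\nabla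 g_{\tau_t,\gamma_t}(U_t,\mathbf{x}_t,V_t)\bigr).$$ Then: 1. $\{(U_t,\mathbf{x}_t,V_t)\}_{t=0}^\infty$ is contained in the compact subset $K_1=V_k(\mathbb{R}^m)\times\hat K_1\times V_k(\mathbb{R}^n)$ of $V_k(\mathbb{R}^m)\times\mathbb{R}^k\times V_k(\mathbb{R}^n)$, where $\hat K_1=\{\mathbf{x}\in\mathbb{R}^k:\|\mathbf{x}\|^2\le\rho_1\}$. Therefore, it has convergent subsequences. 2. $\{\|\nabla G(U_t,\mathbf{x}_t,V_t)\|\}_{t=0}^\infty$ converges almost surely to $0$. 3. Any limit point of $\{(U_t,\mathbf{x}_t,V_t)\}_{t=0}^\infty$ is almost surely a stationary point of $G$.
   Context: $V_k(\mathbb{R}^n)=\{V\in\mathbb{R}^{n\times k}\mid V^TV=I_k\}$ is the Stiefel manifold. $V_k(\mathbb{R}^m)\times\mathbb{R}^k\times V_k(\mathbb{R}^n)$ is a Riemannian submanifold of the Euclidean space $\mathbb{R}^{m\times k}\times\mathbb{R}^k\times\mathbb{R}^{n\times k}$, and $\nabla$ denotes the Riemannian gradient on it. $\|\mathbf{x}\|$ is the Euclidean norm, $\|P\|_F$ the Frobenius norm. $D(\mathbf{x})\in\mathbb{R}^{k\times k}$ denotes the diagonal matrix with diagonal $\mathbf{x}\in\mathbb{R}^k$. $F:\mathbb{R}^{m\times n}\to\mathbb{R}$ is $F(P)=\sum_{i=1}^m\sum_{j=1}^n w_{i,j}(a_{i,j}-p_{i,j})^2+\lambda\|P\|_F^2$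 for $P=[p_{i,j}]$, and $G(U,\mathbf{x},V)=F(UD(\mathbf{x})V^T)$ on $V_k(\mathbb{R}^m)\times\mathbb{R}^k\times V_k(\mathbb{R}^n)$. For $(\tau,\gamma)\in\Omega_{m,n}$, $g_{\tau,\gamma}:V_k(\mathbb{R}^m)\times\mathbb{R}^k\times V_k(\mathbb{R}^n)\to\mathbb{R}$ is $g_{\tau,\gamma}(U,\mathbf{x},V)=(a_{\tau,\gamma}-p_{\tau,\gamma})^2+\lambda\|P\|_F^2$ with $P=[p_{i,j}]=UD(\mathbf{x})V^T$ (note $\|P\|_F=\|\mathbf{x}\|$). Retraction: for a matrix $C$ with linearly independent columns, $\mathrm{qf}(C)=Q$, where $C=QS$ is the QR decomposition with $Q$ having orthonormal columns and $S$ upper triangular with positive diagonal. For $(Y,\hat{\mathbf{x}},Z)\in T_UV_k(\mathbb{R}^m)\times\mathbb{R}^k\times T_VV_k(\mathbb{R}^n)$, $R_{(U,\mathbf{x},V)}(Y,\hat{\mathbf{x}},Z)=(\mathrm{qf}(U+Y),\mathbf{x}+\hat{\mathbf{x}},\mathrm{qf}(V+Z))$. *)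

theory Defs
  imports "HOL-Probability.Probability"
begin

section \<open>Riemannian gradients on embedded submanifolds\<close>

text \<open>
  The set \<open>I\<close> is meant to be open; \<open>d i\<close> is the \<open>i\<close>-th derivative of \<open>c\<close>.
\<close>

definition smooth_curve_on :: "(real \<Rightarrow> 'a::real_normed_vector) \<Rightarrow> real set \<Rightarrow> bool" where
  "smooth_curve_on c I \<longleftrightarrow>
     (\<exists>d. (\<forall>t\<in>I. d (0::nat) t = c t) \<and>
          (\<forall>i. \<forall>t\<in>I. (d i has_vector_derivative d (Suc i) t) (at t)))"

definition curves_through :: "'a::real_normed_vector set \<Rightarrow> 'a \<Rightarrow> (real \<Rightarrow> 'a) set" where
  "curves_through M p =
     {c. c 0 = p \<and> (\<exists>\<delta>>0. smooth_curve_on c {-\<delta><..<\<delta>} \<and> c ` {-\<delta><..<\<delta>} \<subseteq> M)}"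

definition tangent_space :: "'a::real_normed_vector set \<Rightarrow> 'a \<Rightarrow> 'a set" where
  "tangent_space M p = {vector_derivative c (at 0) | c. c \<in> curves_through M p}"

text \<open>
  The metric on \<open>M\<close> is the restriction of the ambient inner product, and the differential of
  \<open>f\<close> on a tangent vector is the derivative of \<open>f\<close> along a curve realising that vector. Only
  the values of \<open>f\<close> on \<open>M\<close> matter.
\<close>

definition is_riemannian_gradient ::
  "'a::real_inner set \<Rightarrow> ('a \<Rightarrow> real) \<Rightarrow> 'a \<Rightarrow> 'a \<Rightarrow> bool" where
  "is_riemannian_gradient M f p v \<longleftrightarrow>
     v \<in> tangent_space M p \<and>
     (\<forall>c\<in>curves_through M p.
        ((\<lambda>t. f (c t)) has_real_derivative (v \<bullet> vector_derivative c (at 0))) (at 0))"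

lemma is_riemannian_gradient_unique:
  assumes "is_riemannian_gradient M f p v" "is_riemannian_gradient M f p v'"
  shows "v = v'"
proof -
  have eq: "v \<bullet> u = v' \<bullet> u" if "u \<in> tangent_space M p" for u
    using that assms unfolding is_riemannian_gradient_def tangent_space_def
    by (auto intro: DERIV_unique)
  have "v \<bullet> v = v' \<bullet> v" "v \<bullet> v' = v' \<bullet> v'"
    using assms by (auto intro!: eq simp: is_riemannian_gradient_def)
  then have "(v - v') \<bullet> (v - v') = 0"
    by (simp add: inner_diff_left inner_diff_right)
  then show ?thesis by simp
qed

definition riemannian_gradient :: "'a::real_inner set \<Rightarrow> ('a \<Rightarrow> real) \<Rightarrow> 'a \<Rightarrow> 'a" where
  "riemannian_gradient M f p = (THE v. is_riemannian_gradient M f p v)"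

definition stationary_point :: "'a::real_inner set \<Rightarrow> ('a \<Rightarrow> real) \<Rightarrow> 'a \<Rightarrow> bool" where
  "stationary_point M f p \<longleftrightarrow> p \<in> M \<and> riemannian_gradient M f p = 0"

section \<open>The Stiefel manifold and the QR retraction\<close>

text \<open>
  An \<open>m \<times> k\<close> matrix has type \<^typ>\<open>real ^ 'k ^ 'm\<close>; the inner product and norm of this type are
  the Frobenius ones, and those of the product type below are the ones of the direct sum.
\<close>

definition stiefel :: "(real ^ 'k ^ 'm) set" where
  "stiefel = {V. transpose V ** V = mat 1}"

type_synonym ('m, 'k, 'n) triple = "(real ^ 'k ^ 'm) \<times> (real ^ 'k) \<times> (real ^ 'k ^ 'n)"

definition param_mfd :: "('m::finite, 'k::finite, 'n::finite) triple set" where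
  "param_mfd = stiefel \<times> UNIV \<times> stiefel"

text \<open>The order on the column index type gives meaning to ``upper triangular''.\<close>

definition is_qr ::
  "real ^ ('k::{finite,linorder}) ^ 'm \<Rightarrow> real ^ ('k::{finite,linorder}) ^ 'm \<Rightarrow>
   real ^ ('k::{finite,linorder}) ^ ('k::{finite,linorder}) \<Rightarrow> bool" where
  "is_qr C Q S \<longleftrightarrow>
     C = Q ** S \<and> transpose Q ** Q = mat 1 \<and>
     (\<forall>i j. j < i \<longrightarrow> S $ i $ j = 0) \<and> (\<forall>i. 0 < S $ i $ i)"

definition qf :: "real ^ ('k::{finite,linorder}) ^ 'm \<Rightarrow> real ^ ('k::{finite,linorder}) ^ 'm" where
  "qf C = (THE Q. \<exists>S. is_qr C Q S)"

fun retract ::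
  "('m::finite, 'k::{finite,linorder}, 'n::finite) triple \<Rightarrow> ('m, 'k, 'n) triple \<Rightarrow>
   ('m, 'k, 'n) triple" where
  "retract (U, x, V) (Y, y, Z) = (qf (U + Y), x + y, qf (V + Z))"

section \<open>The objective functions\<close>

definition diag_mat :: "real ^ 'k \<Rightarrow> real ^ 'k ^ 'k" where
  "diag_mat x = (\<chi> i j. if i = j then x $ i else 0)"

fun svd_prod :: "('m::finite, 'k::finite, 'n::finite) triple \<Rightarrow> real ^ 'n ^ 'm" where
  "svd_prod (U, x, V) = U ** diag_mat x ** transpose V"

definition obj_F :: "real ^ 'n ^ 'm \<Rightarrow> real ^ 'n ^ 'm \<Rightarrow> real \<Rightarrow> real ^ 'n ^ 'm \<Rightarrow> real" where
  "obj_F A W lam P =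
     (\<Sum>i\<in>UNIV. \<Sum>j\<in>UNIV. W $ i $ j * (A $ i $ j - P $ i $ j)\<^sup>2) + lam * (norm P)\<^sup>2"

definition obj_G ::
  "real ^ 'n ^ 'm \<Rightarrow> real ^ 'n ^ 'm \<Rightarrow> real \<Rightarrow> ('m::finite, 'k::finite, 'n::finite) triple \<Rightarrow> real" where
  "obj_G A W lam p = obj_F A W lam (svd_prod p)"

fun sample_g ::
  "real ^ 'n ^ 'm \<Rightarrow> real \<Rightarrow> 'm \<times> 'n \<Rightarrow> ('m::finite, 'k::finite, 'n::finite) triple \<Rightarrow> real" where
  "sample_g A lam (i, j) p =
     (A $ i $ j - svd_prod p $ i $ j)\<^sup>2 + lam * (norm (svd_prod p))\<^sup>2"

end

theory Submission
  imports Defs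
begin

text \<open>
  Along the chart \<open>w \<mapsto> retract p w\<close> the objective satisfies a descent inequality, uniformly over the
  compact set \<open>K\<^sub>1\<close>, because \<open>retract p w = p + w + O(\<bar>w\<bar>\<^sup>2)\<close> for tangent \<open>w\<close>. The step sizes make
  \<open>\<Sum> \<eta>\<^sub>t\<^sup>2 \<bar>v\<^sub>t\<bar>\<^sup>2\<close> bounded by a constant, where \<open>v\<^sub>t\<close> is the sampled gradient. Taking expectations and
  using that \<open>\<eta>\<^sub>t\<close> and the iterate depend only on the past samples, \<open>E \<Sum> \<eta>\<^sub>t \<bar>\<nabla>G\<bar>\<^sup>2\<close> is finite, so
  \<open>\<Sum> \<eta>\<^sub>t \<bar>\<nabla>G\<bar>\<^sup>2\<close> is almost surely finite; no martingale theorem is needed. Since \<open>\<eta>\<^sub>t\<close> dominates a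
  multiple of \<open>1/t\<close> and \<open>\<bar>\<nabla>G\<bar>\<close> changes by at most a multiple of \<open>\<eta>\<^sub>t \<bar>v\<^sub>t\<bar>\<close> per step, it tends to 0.
\<close>

section \<open>QR factorisation and the retraction on the Stiefel manifold\<close>

text \<open>Confinement to \<open>K\<^sub>1\<close> concerns the x-component alone, both Stiefel
  factors being compact: \<open>\<beta>\<close> makes the largest possible step exactly
  \<open>\<kappa>\<close>, and \<open>\<rho>\<^sub>0\<close> is the level of |x|^2 above which the
  worst-case change in one step is no longer positive. The second-order estimate for the retraction
  is obtained without differentiating the QR decomposition: for tangent Y the Gram matrix of U + Y
  is I + Y^T Y, so the triangular factor is the Cholesky factor of a matrix close to I. On the
  manifold the norm of U D(x) V^T is |x|, so the objectives agree there with ambient polynomials;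
  their gradients and the tangent projection are polynomial too, and the Lipschitz bounds are taken
  on balls, which unlike \<open>K\<^sub>1\<close> are convex. Measurability is free: a quantity
  depending on finitely many samples from a finite set takes finitely many values. The two bounds on
  \<epsilon> have separate roles: \<epsilon> > 0 bounds the sum of squared steps, \<epsilon> \<le>
  1/2 keeps the step sizes from decaying too fast.\<close>

lemma bounded_bilinear_matrix_mult:
  "bounded_bilinear ((**) :: real ^ 'k ^ 'm \<Rightarrow> real ^ 'l ^ 'k \<Rightarrow> real ^ 'l ^ 'm)"
proof -
  have "bilinear ((**) :: real ^ 'k ^ 'm \<Rightarrow> real ^ 'l ^ 'k \<Rightarrow> real ^ 'l ^ 'm)"
    unfolding bilinear_def
    by (auto intro!: linearI simp: matrix_matrix_mult_def vec_eq_iff sum.distrib algebra_simps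
        sum_distrib_left)
  then show ?thesis by (simp add: bilinear_conv_bounded_bilinear)
qed

lemma bounded_linear_transpose:
  "bounded_linear (transpose :: real ^ 'k ^ 'm \<Rightarrow> real ^ 'm ^ 'k)"
  unfolding linear_conv_bounded_linear[symmetric]
  by (auto intro!: linearI simp: transpose_def vec_eq_iff)

section \<open>Gram-Schmidt over a finite linearly ordered index type\<close>

lemma stiefel_iff_orthonormal_columns:
  "(U :: real ^ 'k ^ 'm) \<in> stiefel \<longleftrightarrow>
    (\<forall>i j. column i U \<bullet> column j U = (if i = j then 1 else 0))"
  by (auto simp: stiefel_def matrix_mult_transpose_dot_column vec_eq_iff mat_def)

lemma column_component: "column j A $ i = A $ i $ j"
  by (simp add: column_def)

lemma column_matrix_mult:
  "column j (A ** B) = (\<Sum>i\<in>UNIV. B $ i $ j *\<^sub>R column i (A :: real ^ 'k ^ 'm))"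
  by (simp add: column_def matrix_matrix_mult_def vec_eq_iff mult.commute)

text \<open>Columns are indexed by an arbitrary finite linear order, so left-to-right arguments are
  run on the number of smaller indices.\<close>

lemma linorder_finite_induct [case_names less]:
  fixes j :: "'k::{finite,linorder}"
  assumes "\<And>j. (\<And>i. i < j \<Longrightarrow> P i) \<Longrightarrow> P j"
  shows "P j"
proof (induction j rule: measure_induct_rule[where f = "\<lambda>j. card {..<j}"])
  case (less j)
  show ?case
  proof (rule assms)
    fix i assume "i < j"
    then have "{..<i} \<subset> {..<j}" by auto
    then show "P i" by (intro less psubset_card_mono) auto
  qed
qed

text \<open>Linear independence of the columns is used in the form
  \<open>column j C \<notin> col_span_before C j\<close>, which keeps the j-th Gram-Schmidt residual
  nonzero.\<close>

definition col_span_before :: "real ^ ('k::{finite,linorder}) ^ 'm \<Rightarrow> 'k \<Rightarrow> (real ^ 'm) set" where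
  "col_span_before C j = span ((\<lambda>i. column i C) ` {..<j})"

lemma subspace_col_span_before [simp]: "subspace (col_span_before C j)"
  by (simp add: col_span_before_def)

lemma col_span_before_mono: "i \<le> j \<Longrightarrow> col_span_before C i \<subseteq> col_span_before C j"
  unfolding col_span_before_def by (intro span_mono image_mono) auto

lemma column_in_col_span_before: "i < j \<Longrightarrow> column i C \<in> col_span_before C j"
  unfolding col_span_before_def by (intro span_base) auto

lemma is_qr_inner:
  assumes "is_qr C Q S"
  shows "column i Q \<bullet> column j C = S $ i $ j"
proof -
  have "Q \<in> stiefel" "C = Q ** S"
    using assms by (auto simp: is_qr_def stiefel_def)
  then show ?thesis
    by (simp add: column_matrix_mult inner_sum_right stiefel_iff_orthonormal_columns if_distrib[of "times _"]
        cong: if_cong)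
qed

lemma is_qr_column_split:
  assumes "is_qr C Q S"
  shows "column j C = (\<Sum>i\<in>{..<j}. S $ i $ j *\<^sub>R column i Q) + S $ j $ j *\<^sub>R column j Q"
proof -
  have "column j C = (\<Sum>i\<in>UNIV. S $ i $ j *\<^sub>R column i Q)"
    using assms column_matrix_mult by (auto simp: is_qr_def)
  also have "\<dots> = (\<Sum>i\<in>{..j}. S $ i $ j *\<^sub>R column i Q)"
    using assms by (intro sum.mono_neutral_right) (auto simp: is_qr_def not_le)
  also have "{..j} = insert j {..<j}"
    by auto
  finally show ?thesis
    by simp
qed

text \<open>Dividing by the positive diagonal entry solves the equation for
  \<open>column i C\<close> for \<open>column i Q\<close>; the earlier columns of \<open>Q\<close>
  occurring in it are covered by induction.\<close>

lemma is_qr_column_in_span: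
  assumes "is_qr C Q S" "i < j"
  shows "column i Q \<in> col_span_before C j"
  using assms(2)
proof (induction i rule: linorder_finite_induct)
  case (less i)
  have "S $ i $ i *\<^sub>R column i Q = column i C - (\<Sum>l\<in>{..<i}. S $ l $ i *\<^sub>R column l Q)"
    using is_qr_column_split[OF assms(1), of i] by simp
  also have "\<dots> \<in> col_span_before C j"
    using less by (intro subspace_diff subspace_sum subspace_mul column_in_col_span_before
        subspace_col_span_before) auto
  finally have "(1 / S $ i $ i) *\<^sub>R (S $ i $ i *\<^sub>R column i Q) \<in> col_span_before C j"
    by (rule subspace_mul[OF subspace_col_span_before])
  moreover have "S $ i $ i \<noteq> 0"
    using assms(1) by (metis is_qr_def less_irrefl)
  then have "column i Q = (1 / S $ i $ i) *\<^sub>R (S $ i $ i *\<^sub>R column i Q)"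
    by simp
  ultimately show ?case by metis
qed

text \<open>It suffices to test the generators of the span, against which the inner products are
  entries of \<open>S\<close> below the diagonal.\<close>

lemma is_qr_residual_orthogonal:
  assumes "is_qr C Q S" "w \<in> col_span_before C j"
  shows "column j Q \<bullet> w = 0"
proof -
  have "col_span_before C j \<subseteq> {w. column j Q \<bullet> w = 0}"
    unfolding col_span_before_def
  proof (rule span_minimal)
    show "(\<lambda>i. column i C) ` {..<j} \<subseteq> {w. column j Q \<bullet> w = 0}"
      using assms(1) is_qr_inner[OF assms(1)] by (auto simp: is_qr_def)
  qed (simp add: subspace_hyperplane)
  with assms(2) show ?thesis by auto
qed

lemma is_qr_residual:
  assumes "is_qr C Q S"
  obtains y where "y \<in> col_span_before C j" "column j C = y + S $ j $ j *\<^sub>R column j Q"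
proof
  show "(\<Sum>i\<in>{..<j}. S $ i $ j *\<^sub>R column i Q) \<in> col_span_before C j"
    using is_qr_column_in_span[OF assms] by (intro subspace_sum subspace_mul) auto
qed (rule is_qr_column_split[OF assms])

lemma is_qr_norm_column [simp]: "is_qr C Q S \<Longrightarrow> norm (column j Q) = 1"
  using stiefel_iff_orthonormal_columns[of Q] by (simp add: is_qr_def stiefel_def norm_eq_1)

text \<open>Both factorisations split \<open>column j C\<close> into a part in the span of the
  earlier columns and a part orthogonal to it. The orthogonal parts coincide, and unit norm with a
  positive diagonal then fixes the column.\<close>

lemma is_qr_unique:
  assumes "is_qr C Q S" "is_qr C Q' S'"
  shows "Q = Q'"
proof -
  have "column j Q = column j Q'" for j
  proof -
    obtain y where y: "y \<in> col_span_before C j" "column j C = y + S $ j $ j *\<^sub>R column j Q"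
      using is_qr_residual[OF assms(1)] .
    obtain y' where y': "y' \<in> col_span_before C j" "column j C = y' + S' $ j $ j *\<^sub>R column j Q'"
      using is_qr_residual[OF assms(2)] .
    have "y - y' \<in> col_span_before C j"
      using y y' by (intro subspace_diff) auto
    then have "(y - y') \<bullet> column j Q = 0" "(y - y') \<bullet> column j Q' = 0"
      using is_qr_residual_orthogonal assms by (metis inner_commute)+
    moreover have "y - y' = S' $ j $ j *\<^sub>R column j Q' - S $ j $ j *\<^sub>R column j Q"
      using y y' by (simp add: algebra_simps)
    \<comment> \<open>\<open>y - y'\<close> is a combination of two vectors that are both orthogonal
      to it.\<close>
    ultimately have "(y - y') \<bullet> (y - y') = 0"
      by (metis inner_diff_right inner_scaleR_right mult_zero_right diff_self)
    then have eq: "S' $ j $ j *\<^sub>R column j Q' = S $ j $ j *\<^sub>R column j Q"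
      using y y' by simp
    moreover have "0 < S $ j $ j" "0 < S' $ j $ j"
      using assms by (auto simp: is_qr_def)
    moreover have "norm (S' $ j $ j *\<^sub>R column j Q') = norm (S $ j $ j *\<^sub>R column j Q)"
      using eq by simp
    ultimately have "S' $ j $ j = S $ j $ j"
      unfolding norm_scaleR is_qr_norm_column[OF assms(1)] is_qr_norm_column[OF assms(2)] by simp
    with eq \<open>0 < S $ j $ j\<close> show ?thesis by simp
  qed
  then show ?thesis
    by (simp add: vec_eq_iff column_def)
qed

text \<open>Gram-Schmidt without recursion: the residuals \<open>z j\<close> are taken against spans
  of the original columns of \<open>C\<close>, so all of them can be chosen at once, and
  \<open>S\<close> is read off afterwards as the product of the transpose of \<open>Q\<close> with
  \<open>C\<close>.\<close>

lemma is_qr_exists: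
  fixes C :: "real ^ ('k::{finite,linorder}) ^ 'm"
  assumes "\<And>j. column j C \<notin> col_span_before C j"
  shows "\<exists>Q S. is_qr C Q S"
proof -
  have "\<exists>y z. y \<in> col_span_before C j \<and> (\<forall>w\<in>col_span_before C j. z \<bullet> w = 0) \<and> column j C = y + z" for j
    using orthogonal_subspace_decomp_exists[of "(\<lambda>i. column i C) ` {..<j}" "column j C"]
    unfolding col_span_before_def orthogonal_def by metis
  then obtain y z where y: "\<And>j. y j \<in> col_span_before C j"
    and z: "\<And>j w. w \<in> col_span_before C j \<Longrightarrow> z j \<bullet> w = 0"
    and yz: "\<And>j. column j C = y j + z j"
    by metis
  have z0: "z j \<noteq> 0" for j
    using assms[of j] y[of j] yz[of j] by auto
  define q where "q j = z j /\<^sub>R norm (z j)" for j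
  have nq: "norm (q j) = 1" for j
    using z0 by (simp add: q_def)
  have qw: "q j \<bullet> w = 0" if "w \<in> col_span_before C j" for j w
    using z[OF that] by (simp add: q_def)
  have cq: "column j C = y j + norm (z j) *\<^sub>R q j" for j
    using z0 yz by (simp add: q_def)
  have q_span: "q i \<in> col_span_before C j" if "i < j" for i j
  proof -
    have "z i = column i C - y i"
      using yz by simp
    also have "\<dots> \<in> col_span_before C j"
      using that y[of i] subsetD[OF col_span_before_mono[of i j C]] column_in_col_span_before[of i j C]
      by (intro subspace_diff) auto
    finally show ?thesis
      unfolding q_def by (intro subspace_mul) auto
  qed
  have orth: "q i \<bullet> q j = (if i = j then 1 else 0)" for i j
    using nq[of i] q_span[of i j] q_span[of j i] qw[of "q i" j] qw[of "q j" i]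
    by (cases i j rule: linorder_cases) (auto simp: norm_eq_1 inner_commute)
  define Q where "Q = (\<chi> a j. q j $ a)"
  have col: "column j Q = q j" for j
    by (simp add: Q_def column_def vec_eq_iff)
  define S where "S = transpose Q ** C"
  have S: "S $ i $ j = q i \<bullet> column j C" for i j
    by (simp add: S_def matrix_matrix_mult_def transpose_def Q_def inner_vec_def column_def)
  have y_expand: "w = (\<Sum>i\<in>UNIV. (q i \<bullet> w) *\<^sub>R q i)" if "w \<in> span (range q)" for w
  proof -
    obtain u where w: "w = (\<Sum>v\<in>range q. u v *\<^sub>R v)"
      using \<open>w \<in> span (range q)\<close> by (auto simp: span_finite)
    have "inj q"
      by (rule injI) (metis orth zero_neq_one)
    then have w': "w = (\<Sum>i\<in>UNIV. u (q i) *\<^sub>R q i)"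
      unfolding w by (simp add: sum.reindex)
    have "q j \<bullet> w = u (q j)" for j
      unfolding w' by (simp add: inner_sum_right orth if_distrib cong: if_cong)
    with w' show ?thesis by simp
  qed
  have c_span: "column j C \<in> span (range q)" for j
  proof (induction j rule: linorder_finite_induct)
    case (less j)
    then have "col_span_before C j \<subseteq> span (range q)"
      unfolding col_span_before_def by (intro span_minimal) auto
    then have "y j \<in> span (range q)" using y by blast
    then show ?case
      unfolding cq by (intro span_add span_scale) (auto intro: span_base)
  qed
  have "C = Q ** S"
  proof -
    have "column j C = column j (Q ** S)" for j
      using y_expand[OF c_span[of j]] by (simp add: column_matrix_mult col S)
    then show ?thesis
      by (simp add: vec_eq_iff column_def)
  qed
  moreover have "transpose Q ** Q = mat 1"
    by (simp add: matrix_mult_transpose_dot_column col orth vec_eq_iff mat_def)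
  moreover have "S $ i $ j = 0" if "j < i" for i j
    using qw[OF column_in_col_span_before[OF that]] by (simp add: S)
  moreover have "0 < S $ j $ j" for j
    using qw[OF y[of j]] z0[of j] nq[of j] unfolding S cq
    by (simp add: inner_add_right norm_eq_1)
  ultimately show ?thesis
    unfolding is_qr_def by blast
qed

lemma is_qr_qf:
  assumes "\<And>j. column j C \<notin> col_span_before C j"
  shows "\<exists>S. is_qr C (qf C) S"
  unfolding qf_def
  by (rule theI'[where P = "\<lambda>Q. \<exists>S. is_qr C Q S"])
    (use is_qr_exists[OF assms] is_qr_unique in blast)

section \<open>Second-order estimate for \<open>qf\<close> at a tangent perturbation\<close>

lemma norm_square_columns:
  "(norm (A :: real ^ 'k ^ 'm))\<^sup>2 = (\<Sum>j\<in>UNIV. (norm (column j A))\<^sup>2)"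
  unfolding power2_norm_eq_inner inner_vec_def column_def by simp (rule sum.swap)

text \<open>Serves both to carry the bound on \<open>S - mat 1\<close> over to
  \<open>C - qf C\<close> and to compute the Frobenius norm of U D(x) V^T.\<close>

lemma norm_stiefel_mult:
  fixes U :: "real ^ 'k ^ 'm" and X :: "real ^ 'l ^ 'k"
  assumes "U \<in> stiefel"
  shows "norm (U ** X) = norm X"
proof -
  have col: "norm (column j (U ** X)) = norm (column j X)" for j
  proof -
    have "(norm (column j (U ** X)))\<^sup>2 = (norm (column j X))\<^sup>2"
      unfolding power2_norm_eq_inner column_matrix_mult inner_sum_left inner_sum_right
      using assms column_component[of j X]
      by (simp add: stiefel_iff_orthonormal_columns if_distrib[of "times _"]
          inner_vec_def[of "column j X"] cong: if_cong)
    then show ?thesis by simp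
  qed
  show ?thesis
    by (rule power2_eq_imp_eq) (simp_all add: norm_square_columns col)
qed

lemma norm_column_le_norm: "norm (column j (A :: real ^ 'k ^ 'm)) \<le> norm A"
proof -
  have "(norm (column j A))\<^sup>2 \<le> (norm A)\<^sup>2"
    unfolding power2_norm_eq_inner inner_vec_def column_def
    by simp (intro sum_mono member_le_sum, auto)
  then show ?thesis by simp
qed

text \<open>
  The column norms alone only bound the off-diagonal entries by a multiple of \<open>sqrt b\<close>; the mixed
  Gram entries, solved for \<open>S $ i $ i * S $ i $ j\<close>, improve this to a multiple of \<open>b\<close>.
\<close>

lemma cholesky_perturbation:
  fixes S :: "real ^ ('k::{finite,linorder}) ^ ('k::{finite,linorder})"
  assumes up: "\<And>i j. j < i \<Longrightarrow> S $ i $ j = 0" and diag: "\<And>i. 1 \<le> S $ i $ i"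
    and gram: "\<And>i j. \<bar>(\<Sum>l\<in>UNIV. S $ l $ i * S $ l $ j) - (if i = j then 1 else 0)\<bar> \<le> b"
  shows "\<bar>S $ i $ j - (if i = j then 1 else 0)\<bar> \<le> 2 * b"
proof -
  have b: "0 \<le> b"
    using gram[of i i] by linarith
  have split: "(\<Sum>l\<in>UNIV. S $ l $ j * S $ l $ j) = (S $ j $ j)\<^sup>2 + (\<Sum>l\<in>-{j}. (S $ l $ j)\<^sup>2)" for j
    by (subst sum.remove[of UNIV j]) (auto simp: power2_eq_square Compl_eq_Diff_UNIV)
  \<comment> \<open>The squared diagonal entry already accounts for the 1 in the Gram entry, so the
    other entries of the column share at most \<open>b\<close>.\<close>
  have off: "(\<Sum>l\<in>-{j}. (S $ l $ j)\<^sup>2) \<le> b" for j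
    using gram[of j j] split[of j] one_le_power[OF diag[of j], of 2] by simp
  have diag': "S $ j $ j - 1 \<le> b" for j
  proof -
    have "S $ j $ j - 1 \<le> (S $ j $ j)\<^sup>2 - 1"
      using self_le_power[OF diag[of j], of 2] by simp
    also have "\<dots> \<le> b"
      using gram[of j j] split[of j] sum_nonneg[of "-{j}" "\<lambda>l. (S $ l $ j)\<^sup>2"] by simp
    finally show ?thesis .
  qed
  show ?thesis
  proof (cases i j rule: linorder_cases)
    case less
    have zero: "S $ l $ i * S $ l $ j = 0" if "l \<notin> {..i}" for l
      using up[of i l] that by simp
    have "(\<Sum>l\<in>UNIV. S $ l $ i * S $ l $ j) = (\<Sum>l\<in>{..i}. S $ l $ i * S $ l $ j)"
      using zero by (intro sum.mono_neutral_right) auto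
    also have "{..i} = insert i {..<i}" by auto
    finally have sum: "(\<Sum>l\<in>UNIV. S $ l $ i * S $ l $ j)
        = S $ i $ i * S $ i $ j + (\<Sum>l\<in>{..<i}. S $ l $ i * S $ l $ j)"
      by simp
    \<comment> \<open>The indices \<open>l < i < j\<close> are off-diagonal in both columns, so
      AM-GM and \<open>off\<close> bound the mixed products by \<open>b\<close>, with no factor of
      the dimension.\<close>
    have "\<bar>\<Sum>l\<in>{..<i}. S $ l $ i * S $ l $ j\<bar> \<le> (\<Sum>l\<in>{..<i}. ((S $ l $ i)\<^sup>2 + (S $ l $ j)\<^sup>2) / 2)"
    proof (rule order_trans[OF sum_abs sum_mono])
      fix l
      show "\<bar>S $ l $ i * S $ l $ j\<bar> \<le> ((S $ l $ i)\<^sup>2 + (S $ l $ j)\<^sup>2) / 2"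
        using sum_squares_bound[of "\<bar>S $ l $ i\<bar>" "\<bar>S $ l $ j\<bar>"] by (simp add: abs_mult)
    qed
    also have "\<dots> = ((\<Sum>l\<in>{..<i}. (S $ l $ i)\<^sup>2) + (\<Sum>l\<in>{..<i}. (S $ l $ j)\<^sup>2)) / 2"
      by (simp add: sum.distrib[symmetric] sum_divide_distrib)
    also have "\<dots> \<le> ((\<Sum>l\<in>-{i}. (S $ l $ i)\<^sup>2) + (\<Sum>l\<in>-{j}. (S $ l $ j)\<^sup>2)) / 2"
      using less by (intro divide_right_mono add_mono sum_mono2) auto
    also have "\<dots> \<le> b"
      using off[of i] off[of j] by simp
    finally have "\<bar>S $ i $ i * S $ i $ j\<bar> \<le> 2 * b"
      using gram[of i j] less_imp_neq[OF less] unfolding sum by simp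
    moreover have "\<bar>S $ i $ j\<bar> \<le> \<bar>S $ i $ i * S $ i $ j\<bar>"
      using diag[of i] mult_right_mono[OF diag[of i], of "\<bar>S $ i $ j\<bar>"] by (simp add: abs_mult)
    ultimately show ?thesis
      using less_imp_neq[OF less] by simp
  next
    case equal
    then show ?thesis
      using diag[of j] diag'[of j] b by simp
  next
    case greater
    then show ?thesis
      using up b less_imp_neq[OF greater] by simp
  qed
qed

text \<open>The terms linear in \<open>Y\<close> cancel by skewness of U^T Y. This makes the
  normalisation performed by \<open>qf\<close> a second-order correction.\<close>

lemma stiefel_plus_tangent_gram:
  fixes U Y :: "real ^ 'k ^ 'm"
  assumes "U \<in> stiefel" "transpose U ** Y + transpose Y ** U = 0"
  shows "column i (U + Y) \<bullet> column j (U + Y)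
    = (if i = j then 1 else 0) + column i Y \<bullet> column j Y"
proof -
  have "(transpose U ** Y + transpose Y ** U) $ i $ j = 0"
    using assms(2) by simp
  then have "column i U \<bullet> column j Y + column i Y \<bullet> column j U = 0"
    by (simp add: matrix_matrix_mult_def transpose_def column_def inner_vec_def)
  moreover have "column l (U + Y) = column l U + column l Y" for l
    by (simp add: column_def vec_eq_iff)
  ultimately show ?thesis
    using assms(1)
    by (simp add: inner_add_left inner_add_right stiefel_iff_orthonormal_columns)
qed

text \<open>The Gram matrix I + Y^T Y dominates I. Hence QR is available at every tangent
  \<open>Y\<close>, with no smallness assumption.\<close>

lemma norm_stiefel_plus_tangent:
  fixes U Y :: "real ^ 'k ^ 'm"
  assumes "U \<in> stiefel" "transpose U ** Y + transpose Y ** U = 0"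
  shows "norm x \<le> norm ((U + Y) *v x)"
proof -
  have mv: "A *v x = (\<Sum>i\<in>UNIV. x $ i *\<^sub>R column i A)" for A :: "real ^ 'k ^ 'm"
    by (simp add: matrix_mult_sum scalar_mult_eq_scaleR)
  have "(norm ((U + Y) *v x))\<^sup>2
      = (\<Sum>i\<in>UNIV. \<Sum>j\<in>UNIV. x $ j * (x $ i * (column i (U + Y) \<bullet> column j (U + Y))))"
    unfolding power2_norm_eq_inner mv
    by (simp add: inner_sum_left inner_sum_right sum_distrib_left inner_commute mult_ac)
  also have "\<dots> = (\<Sum>i\<in>UNIV. \<Sum>j\<in>UNIV. x $ j * (x $ i * (if i = j then 1 else 0)))
      + (\<Sum>i\<in>UNIV. \<Sum>j\<in>UNIV. x $ j * (x $ i * (column i Y \<bullet> column j Y)))"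
    by (simp add: stiefel_plus_tangent_gram[OF assms] distrib_left sum.distrib)
  also have "\<dots> = (norm x)\<^sup>2 + (norm (Y *v x))\<^sup>2"
    unfolding power2_norm_eq_inner mv
    by (simp add: inner_sum_left inner_sum_right sum_distrib_left inner_vec_def[of x x]
        if_distrib[of "times _"] inner_commute mult_ac cong: if_cong)
  finally show ?thesis
    by (intro power2_le_imp_le[of "norm x"]) auto
qed

text \<open>The triangular factor of U + Y is the Cholesky factor of I + Y^T Y. Its diagonal entries
  are distances of a column from the span of the earlier ones, hence at least 1, and
  \<open>cholesky_perturbation\<close> applies with b = |Y|^2.\<close>

theorem qf_stiefel_plus_tangent:
  fixes U Y :: "real ^ ('k::{finite,linorder}) ^ 'm"
  assumes U: "U \<in> stiefel" and Y: "transpose U ** Y + transpose Y ** U = 0"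
  shows "qf (U + Y) \<in> stiefel"
    and "norm (qf (U + Y) - (U + Y)) \<le> 2 * (real CARD('k))\<^sup>2 * (norm Y)\<^sup>2"
proof -
  define C where "C = U + Y"
  \<comment> \<open>An element of that span is the image under \<open>C\<close> of some
    \<open>x\<close> with \<open>x $ j = 0\<close>, so the difference is the image of
    \<open>axis j 1 - x\<close>, whose j-th entry is 1.\<close>
  have dist: "1 \<le> norm (column j C - y)" if "y \<in> col_span_before C j" for j y
  proof -
    have "col_span_before C j \<subseteq> {C *v x | x. x $ j = 0}"
      unfolding col_span_before_def
    proof (rule span_minimal)
      show "(\<lambda>i. column i C) ` {..<j} \<subseteq> {C *v x |x. x $ j = 0}"
      proof (rule image_subsetI)
        fix i assume "i \<in> {..<j}"
        then have "column i C = C *v axis i 1 \<and> axis i (1 :: real) $ j = 0"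
          by (simp add: matrix_vector_mult_basis) (auto simp: axis_def)
        then show "column i C \<in> {C *v x |x. x $ j = 0}"
          by blast
      qed
      show "subspace {C *v x |x. x $ j = 0}"
        unfolding subspace_def
      proof (intro conjI ballI allI)
        show "0 \<in> {C *v x |x. x $ j = 0}"
          by (auto intro!: exI[of _ 0])
      next
        fix a b assume "a \<in> {C *v x |x. x $ j = 0}" "b \<in> {C *v x |x. x $ j = 0}"
        then obtain u v where "a = C *v u" "u $ j = 0" "b = C *v v" "v $ j = 0" by auto
        then show "a + b \<in> {C *v x |x. x $ j = 0}"
          by (auto intro!: exI[of _ "u + v"] simp: matrix_vector_right_distrib)
      next
        fix c a assume "a \<in> {C *v x |x. x $ j = 0}"
        then obtain u where "a = C *v u" "u $ j = 0" by auto
        then show "c *\<^sub>R a \<in> {C *v x |x. x $ j = 0}"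
          by (auto intro!: exI[of _ "c *\<^sub>R u"] simp: matrix_vector_mult_scaleR)
      qed
    qed
    with that obtain x where x: "y = C *v x" "x $ j = 0" by auto
    have "column j C - y = C *v (axis j 1 - x)"
      unfolding x matrix_vector_mult_diff_distrib
      by (simp add: matrix_vector_mult_basis)
    moreover have "1 \<le> norm (axis j 1 - x)"
      using component_le_norm_cart[of "axis j 1 - x" j] x by simp
    ultimately show ?thesis
      using norm_stiefel_plus_tangent[OF U Y, of "axis j 1 - x"] by (simp add: C_def)
  qed
  have "column j C \<notin> col_span_before C j" for j
    using dist[of "column j C" j] by auto
  then obtain S where qr: "is_qr C (qf C) S"
    using is_qr_qf by blast
  then have C_eq: "C = qf C ** S" and orth: "transpose (qf C) ** qf C = mat 1"
    and up: "\<And>i j. j < i \<Longrightarrow> S $ i $ j = 0" and pos: "\<And>j. 0 < S $ j $ j"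
    unfolding is_qr_def by blast+
  show Q: "qf (U + Y) \<in> stiefel"
    using orth by (simp add: stiefel_def C_def)
  have diag: "1 \<le> S $ j $ j" for j
  proof -
    obtain y where "y \<in> col_span_before C j" "column j C = y + S $ j $ j *\<^sub>R column j (qf C)"
      using is_qr_residual[OF qr] .
    then have "1 \<le> norm (S $ j $ j *\<^sub>R column j (qf C))"
      using dist[of y j] by simp
    then show ?thesis
      using pos[of j] qr by simp
  qed
  have gram: "\<bar>(\<Sum>l\<in>UNIV. S $ l $ i * S $ l $ j) - (if i = j then 1 else 0)\<bar> \<le> (norm Y)\<^sup>2" for i j
  proof -
    have "column i C \<bullet> column j C = (\<Sum>l\<in>UNIV. S $ l $ i * S $ l $ j)"
    proof -
      have "column i C = (\<Sum>l\<in>UNIV. S $ l $ i *\<^sub>R column l (qf C))"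
        using C_eq column_matrix_mult by metis
      then have "column i C \<bullet> column j C = (\<Sum>l\<in>UNIV. S $ l $ i *\<^sub>R column l (qf C)) \<bullet> column j C"
        by (rule arg_cong)
      then show ?thesis
        by (simp only: inner_sum_left inner_scaleR_left is_qr_inner[OF qr])
    qed
    moreover have "\<bar>column i Y \<bullet> column j Y\<bar> \<le> (norm Y)\<^sup>2"
      unfolding power2_eq_square
      by (rule order_trans[OF Cauchy_Schwarz_ineq2 mult_mono]) (auto simp: norm_column_le_norm)
    ultimately show ?thesis
      using stiefel_plus_tangent_gram[OF U Y, of i j] by (simp add: C_def)
  qed
  have entry: "\<bar>(S - mat 1) $ i $ j\<bar> \<le> 2 * (norm Y)\<^sup>2" for i j
    using cholesky_perturbation[of S "(norm Y)\<^sup>2" i j] up diag gram by (simp add: mat_def)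
  \<comment> \<open>The factor k^2 is the number of entries; only the order in |Y| matters
    later.\<close>
  have "norm (S - mat 1) \<le> (\<Sum>i\<in>UNIV. norm ((S - mat 1) $ i))"
    by (subst norm_vec_def) (rule L2_set_le_sum, simp)
  also have "\<dots> \<le> (\<Sum>i\<in>(UNIV :: 'k set). \<Sum>j\<in>(UNIV :: 'k set). 2 * (norm Y)\<^sup>2)"
    by (intro sum_mono order_trans[OF norm_le_l1_cart]) (rule entry)
  also have "\<dots> = 2 * (real CARD('k))\<^sup>2 * (norm Y)\<^sup>2"
    by (simp add: power2_eq_square)
  finally have "norm (S - mat 1) \<le> 2 * (real CARD('k))\<^sup>2 * (norm Y)\<^sup>2" .
  \<comment> \<open>As C = Q S, the error is Q (S - I), and Q preserves the Frobenius norm.\<close>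
  moreover have "C - qf C = qf C ** (S - mat 1)"
    using C_eq by (metis bounded_bilinear.diff_right[OF bounded_bilinear_matrix_mult] matrix_mul_rid)
  ultimately show "norm (qf (U + Y) - (U + Y)) \<le> 2 * (real CARD('k))\<^sup>2 * (norm Y)\<^sup>2"
    using norm_stiefel_mult[OF Q, of "S - mat 1"] by (simp add: C_def norm_minus_commute)
qed

section \<open>Tangent spaces and Riemannian gradients\<close>

text \<open>The solution is the exponential series of t T applied to x. Taking components reduces
  differentiability to termwise differentiation of real power series.\<close>

lemma linear_ode_exists:
  fixes T :: "'a::euclidean_space \<Rightarrow> 'a"
  assumes T: "bounded_linear T"
  obtains c where "c 0 = x" "\<And>t. (c has_vector_derivative T (c t)) (at t)"
proof -
  obtain K where K: "0 \<le> K" "\<And>v. norm (T v) \<le> norm v * K"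
    using bounded_linear.nonneg_bounded[OF T] by blast
  have bound: "norm ((T ^^ n) v) \<le> K ^ n * norm v" for n v
  proof (induction n)
    case (Suc n)
    have "norm ((T ^^ Suc n) v) \<le> norm ((T ^^ n) v) * K"
      using K(2) by simp
    also have "\<dots> \<le> K ^ n * norm v * K"
      using Suc K(1) by (rule mult_right_mono)
    finally show ?case by (simp add: mult_ac)
  qed simp
  define a where "a v t n = (t ^ n / fact n) *\<^sub>R (T ^^ n) v" for v and t :: real and n
  have sum_a: "summable (a v t)" for v t
  proof (rule summable_comparison_test')
    show "summable (\<lambda>n. norm v * (inverse (fact n) * (\<bar>t\<bar> * K) ^ n))"
      by (intro summable_mult summable_exp)
    fix n :: nat
    have "norm (a v t n) = \<bar>t\<bar> ^ n / fact n * norm ((T ^^ n) v)"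
      by (simp add: a_def power_abs)
    also have "\<dots> \<le> \<bar>t\<bar> ^ n / fact n * (K ^ n * norm v)"
      using bound by (intro mult_left_mono) auto
    also have "\<dots> = norm v * (inverse (fact n) * (\<bar>t\<bar> * K) ^ n)"
      by (simp add: power_mult_distrib divide_inverse mult_ac)
    finally show "norm (a v t n) \<le> norm v * (inverse (fact n) * (\<bar>t\<bar> * K) ^ n)" .
  qed
  define c where "c t = suminf (a x t)" for t
  have "(c has_vector_derivative T (c t)) (at t)" for t
    unfolding has_vector_derivative_def
  proof (rule iffD2[OF has_derivative_componentwise_within], rule ballI)
    fix b :: 'a assume "b \<in> Basis"
    define f where "f v n = ((T ^^ n) v \<bullet> b) / fact n" for v n
    have f: "summable (\<lambda>n. f v n * s ^ n)" "(\<Sum>n. f v n * s ^ n) = suminf (a v s) \<bullet> b" for v s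
    proof -
      have "(\<lambda>n. a v s n \<bullet> b) sums (suminf (a v s) \<bullet> b)"
        by (intro bounded_linear.sums[OF bounded_linear_inner_left] summable_sums sum_a)
      moreover have "(\<lambda>n. a v s n \<bullet> b) = (\<lambda>n. f v n * s ^ n)"
        by (simp add: a_def f_def fun_eq_iff)
      ultimately show "summable (\<lambda>n. f v n * s ^ n)" "(\<Sum>n. f v n * s ^ n) = suminf (a v s) \<bullet> b"
        by (auto simp: sums_iff)
    qed
    have "((\<lambda>s. \<Sum>n. f x n * s ^ n) has_field_derivative (\<Sum>n. diffs (f x) n * t ^ n)) (at t)"
      by (rule termdiffs_strong_converges_everywhere) (rule f)
    \<comment> \<open>Differentiating the exponential series shifts its coefficients, which amounts
      to replacing \<open>x\<close> by \<open>T x\<close>.\<close>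
    moreover have "diffs (f x) = f (T x)"
      by (simp add: diffs_def f_def fun_eq_iff funpow_swap1 del: of_nat_Suc)
    moreover have "suminf (a (T x) t) = T (c t)"
    proof -
      have lin: "(T ^^ n) (T x) = T ((T ^^ n) x)" for n
        by (simp add: funpow_swap1)
      have "a (T x) t = (\<lambda>n. T (a x t n))"
        by (simp add: a_def lin linear_scale[OF bounded_linear.linear[OF T]] fun_eq_iff)
      then show ?thesis
        by (simp add: c_def bounded_linear.suminf[OF T sum_a])
    qed
    ultimately have "((\<lambda>s. c s \<bullet> b) has_field_derivative (T (c t) \<bullet> b)) (at t)"
      by (simp add: f c_def)
    then show "((\<lambda>s. c s \<bullet> b) has_derivative (\<lambda>s. (s *\<^sub>R T (c t)) \<bullet> b)) (at t)"
      by (simp add: has_field_derivative_def mult.commute[of _ "T (c t) \<bullet> b"])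
  qed
  moreover have "c 0 = x"
  proof -
    have "a x 0 = (\<lambda>n. if n = 0 then x else 0)"
      by (auto simp: a_def fun_eq_iff)
    then show ?thesis
      using sums_unique[OF sums_single[of 0 "\<lambda>_. x"]] by (simp add: c_def)
  qed
  ultimately show ?thesis using that by blast
qed

lemma smooth_curve_on_linear_ode:
  assumes T: "bounded_linear T" and c: "\<And>t. (c has_vector_derivative T (c t)) (at t)"
  shows "smooth_curve_on c I"
  unfolding smooth_curve_on_def
proof (intro exI[of _ "\<lambda>i t. (T ^^ i) (c t)"] conjI ballI allI)
  have lin: "bounded_linear (T ^^ i)" for i
    by (induction i) (auto simp: o_def intro: bounded_linear_compose[OF T] bounded_linear_ident
        simp: id_def)
  fix t i
  show "((\<lambda>t. (T ^^ i) (c t)) has_vector_derivative (T ^^ Suc i) (c t)) (at t)"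
    using bounded_linear.has_vector_derivative[OF lin c, of i t] by (simp add: funpow_swap1)
qed simp

lemma smooth_curve_on_affine: "smooth_curve_on (\<lambda>t. x + t *\<^sub>R y) I"
proof -
  define d where "d i t = (if i = 0 then x + t *\<^sub>R y else if i = 1 then y else 0)"
    for i :: nat and t :: real
  have "(d i has_vector_derivative d (Suc i) t) (at t)" for i t
    unfolding d_def by (cases i) (auto intro!: derivative_eq_intros)
  moreover have "d 0 t = x + t *\<^sub>R y" for t
    by (simp add: d_def)
  ultimately show ?thesis
    unfolding smooth_curve_on_def by blast
qed

lemma smooth_curve_on_Pair:
  assumes "smooth_curve_on c I" "smooth_curve_on c' I"
  shows "smooth_curve_on (\<lambda>t. (c t, c' t)) I"
proof -
  obtain d d' where d: "\<forall>t\<in>I. d 0 t = c t" "\<forall>i. \<forall>t\<in>I. (d i has_vector_derivative d (Suc i) t) (at t)"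
    and d': "\<forall>t\<in>I. d' 0 t = c' t" "\<forall>i. \<forall>t\<in>I. (d' i has_vector_derivative d' (Suc i) t) (at t)"
    using assms unfolding smooth_curve_on_def by metis
  then show ?thesis
    unfolding smooth_curve_on_def
    by (intro exI[of _ "\<lambda>i t. (d i t, d' i t)"]) (auto intro!: has_vector_derivative_Pair)
qed

text \<open>The kernel of the differential of U^T U: the tangent space given by equations. It is
  matched with the definition by curves in \<open>stiefel_curve\<close> and
  \<open>stiefel_curve_tangent\<close>.\<close>

definition stiefel_tangent :: "real ^ 'k ^ 'm \<Rightarrow> (real ^ 'k ^ 'm) set" where
  "stiefel_tangent U = {Y. transpose U ** Y + transpose Y ** U = 0}"

lemma transpose_add: "transpose (A + B) = transpose A + transpose (B :: real ^ 'k ^ 'm)"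
  by (rule linear_add[OF bounded_linear.linear[OF bounded_linear_transpose]])

lemma transpose_diff: "transpose (A - B) = transpose A - transpose (B :: real ^ 'k ^ 'm)"
  by (rule linear_diff[OF bounded_linear.linear[OF bounded_linear_transpose]])

lemmas matrix_mult_bilinear_simps =
  bounded_bilinear.add_left[OF bounded_bilinear_matrix_mult]
  bounded_bilinear.add_right[OF bounded_bilinear_matrix_mult]
  bounded_bilinear.diff_left[OF bounded_bilinear_matrix_mult]
  bounded_bilinear.diff_right[OF bounded_bilinear_matrix_mult]
  bounded_bilinear.minus_left[OF bounded_bilinear_matrix_mult]
  bounded_bilinear.minus_right[OF bounded_bilinear_matrix_mult]
  bounded_bilinear.scaleR_left[OF bounded_bilinear_matrix_mult]
  bounded_bilinear.scaleR_right[OF bounded_bilinear_matrix_mult]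

text \<open>
  The flow of the skew matrix \<open>\<Omega> = Y U\<^sup>T - U Y\<^sup>T - U (U\<^sup>T Y) U\<^sup>T\<close>, which satisfies \<open>\<Omega> U = Y\<close>,
  preserves the Stiefel manifold.
\<close>

lemma stiefel_curve:
  fixes U Y :: "real ^ 'k ^ 'm"
  assumes U: "U \<in> stiefel" and Y: "Y \<in> stiefel_tangent U"
  obtains c where "c 0 = U" "smooth_curve_on c UNIV" "\<And>t. c t \<in> stiefel"
    "(c has_vector_derivative Y) (at 0)"
proof -
  define \<Omega> where "\<Omega> = Y ** transpose U - U ** transpose Y - U ** (transpose U ** Y) ** transpose U"
  have UU: "transpose U ** U = mat 1"
    using U by (simp add: stiefel_def)
  have skew': "transpose Y ** U = - (transpose U ** Y)"
    using Y by (simp add: stiefel_tangent_def eq_neg_iff_add_eq_0 add.commute)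
  have skew: "transpose \<Omega> = - \<Omega>"
  proof -
    have "transpose \<Omega> = U ** transpose Y - Y ** transpose U - U ** (transpose Y ** U) ** transpose U"
      by (simp add: \<Omega>_def transpose_diff matrix_transpose_mul matrix_mul_assoc)
    then show ?thesis
      unfolding skew' by (simp add: \<Omega>_def matrix_mult_bilinear_simps)
  qed
  have \<Omega>U: "\<Omega> ** U = Y"
  proof -
    have "\<Omega> ** U = Y ** (transpose U ** U) - U ** (transpose Y ** U)
        - U ** (transpose U ** Y) ** (transpose U ** U)"
      unfolding \<Omega>_def matrix_mult_bilinear_simps matrix_mul_assoc ..
    then show ?thesis
      unfolding UU skew' by (simp add: matrix_mult_bilinear_simps)
  qed
  have lin: "bounded_linear (\<lambda>A :: real ^ 'k ^ 'm. \<Omega> ** A)"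
    by (rule bounded_bilinear.bounded_linear_right[OF bounded_bilinear_matrix_mult])
  obtain c where c: "c 0 = U" "\<And>t. (c has_vector_derivative \<Omega> ** c t) (at t)"
    using linear_ode_exists[OF lin] by metis
  have "((\<lambda>t. transpose (c t) ** c t) has_vector_derivative 0) (at t)" for t
  proof -
    have "((\<lambda>t. transpose (c t) ** c t) has_vector_derivative
        transpose (c t) ** (\<Omega> ** c t) + transpose (\<Omega> ** c t) ** c t) (at t)"
      by (intro bounded_bilinear.has_vector_derivative[OF bounded_bilinear_matrix_mult]
          bounded_linear.has_vector_derivative[OF bounded_linear_transpose] c)
    moreover have "transpose (c t) ** (\<Omega> ** c t) + transpose (\<Omega> ** c t) ** c t = 0"
      by (simp add: matrix_transpose_mul skew matrix_mult_bilinear_simps matrix_mul_assoc)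
    ultimately show ?thesis by simp
  qed
  then obtain C where C: "\<And>t. transpose (c t) ** c t = C"
    using has_vector_derivative_zero_constant[of UNIV "\<lambda>t. transpose (c t) ** c t"] by auto
  have "c t \<in> stiefel" for t
    using C[of t] C[of 0] UU by (simp add: stiefel_def c(1))
  moreover have "(c has_vector_derivative Y) (at 0)"
    using c(2)[of 0] by (simp add: c(1) \<Omega>U)
  ultimately show ?thesis
    using that c(1) smooth_curve_on_linear_ode[OF lin c(2)] by blast
qed

text \<open>Differentiate the constraint, which is constant along the curve near 0.\<close>

lemma stiefel_curve_tangent:
  assumes c: "(c has_vector_derivative Y) (at 0)"
    and \<delta>: "0 < \<delta>" "\<And>t. t \<in> {-\<delta><..<\<delta>} \<Longrightarrow> c t \<in> stiefel"
  shows "Y \<in> stiefel_tangent (c 0)"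
proof -
  have "((\<lambda>t. transpose (c t) ** c t) has_vector_derivative
      transpose (c 0) ** Y + transpose Y ** c 0) (at 0)"
    by (intro bounded_bilinear.has_vector_derivative[OF bounded_bilinear_matrix_mult]
        bounded_linear.has_vector_derivative[OF bounded_linear_transpose] c)
  moreover have "((\<lambda>t. transpose (c t) ** c t) has_vector_derivative 0) (at 0)"
    by (rule has_vector_derivative_transform_within_open[where f = "\<lambda>_. mat 1"
        and S = "{-\<delta><..<\<delta>}"])
      (use \<delta> in \<open>auto simp: stiefel_def\<close>)
  ultimately show ?thesis
    unfolding stiefel_tangent_def by (simp add: vector_derivative_unique_at)
qed

section \<open>Tangent vectors and gradients on the parameter manifold\<close>

definition mfd_tangent :: "('m::finite, 'k::finite, 'n::finite) triple \<Rightarrow> ('m, 'k, 'n) triple set" where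
  "mfd_tangent p = stiefel_tangent (fst p) \<times> UNIV \<times> stiefel_tangent (snd (snd p))"

text \<open>\<open>vector_derivative\<close> is a choice operator, so differentiability has to be
  supplied. Smoothness provides it for \<open>d 0\<close>, which is known to equal \<open>c\<close>
  only near 0.\<close>

lemma curves_through_has_vector_derivative:
  assumes "c \<in> curves_through M p"
  shows "(c has_vector_derivative vector_derivative c (at 0)) (at 0)"
proof -
  obtain \<delta> d where \<delta>: "0 < \<delta>" and d: "\<forall>t\<in>{-\<delta><..<\<delta>}. d (0::nat) t = c t"
      "\<forall>i. \<forall>t\<in>{-\<delta><..<\<delta>}. (d i has_vector_derivative d (Suc i) t) (at t)"
    using assms by (auto simp: curves_through_def smooth_curve_on_def)
  have "(c has_vector_derivative d 1 0) (at 0)"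
    by (rule has_vector_derivative_transform_within_open[where f = "d 0" and S = "{-\<delta><..<\<delta>}"])
      (use \<delta> d in auto)
  then show ?thesis
    using vector_derivative_works differentiableI_vector by blast
qed

lemma curves_through_param_mfd_tangent:
  fixes p :: "('m::finite, 'k::finite, 'n::finite) triple"
  assumes "c \<in> curves_through param_mfd p"
  shows "vector_derivative c (at 0) \<in> mfd_tangent p"
proof -
  let ?w = "vector_derivative c (at 0)"
  have c: "(c has_vector_derivative ?w) (at 0)"
    by (rule curves_through_has_vector_derivative[OF assms])
  obtain \<delta> where \<delta>: "0 < \<delta>" "c ` {-\<delta><..<\<delta>} \<subseteq> param_mfd" and p: "c 0 = p"
    using assms by (auto simp: curves_through_def)
  have "((\<lambda>t. fst (c t)) has_vector_derivative fst ?w) (at 0)"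
    "((\<lambda>t. snd (snd (c t))) has_vector_derivative snd (snd ?w)) (at 0)"
    by (intro bounded_linear.has_vector_derivative[OF bounded_linear_fst]
        bounded_linear.has_vector_derivative[OF bounded_linear_snd] c)+
  moreover have "fst (c t) \<in> stiefel" "snd (snd (c t)) \<in> stiefel" if "t \<in> {-\<delta><..<\<delta>}" for t
    using \<delta>(2) that by (force simp: param_mfd_def)+
  ultimately have "fst ?w \<in> stiefel_tangent (fst (c 0))"
    "snd (snd ?w) \<in> stiefel_tangent (snd (snd (c 0)))"
    using stiefel_curve_tangent[OF _ \<delta>(1)] by blast+
  then show ?thesis
    by (simp add: mfd_tangent_def p mem_Times_iff)
qed

text \<open>A Riemannian gradient must be the velocity of an actual curve in the manifold: flows of
  skew matrices serve in the Stiefel factors, a straight line in the middle.\<close>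

lemma mfd_tangent_subset_tangent_space:
  fixes p :: "('m::finite, 'k::finite, 'n::finite) triple"
  assumes p: "p \<in> param_mfd" and w: "w \<in> mfd_tangent p"
  shows "w \<in> tangent_space param_mfd p"
proof -
  obtain U x V where p_eq: "p = (U, x, V)" by (cases p)
  obtain Y y Z where w_eq: "w = (Y, y, Z)" by (cases w)
  have U: "U \<in> stiefel" and V: "V \<in> stiefel"
    and Y: "Y \<in> stiefel_tangent U" and Z: "Z \<in> stiefel_tangent V"
    using p w by (auto simp: p_eq w_eq param_mfd_def mfd_tangent_def)
  obtain b where b: "b 0 = U" "smooth_curve_on b UNIV" "\<And>t. b t \<in> stiefel"
      "(b has_vector_derivative Y) (at 0)"
    by (rule stiefel_curve[OF U Y]) blast
  obtain d where d: "d 0 = V" "smooth_curve_on d UNIV" "\<And>t. d t \<in> stiefel"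
      "(d has_vector_derivative Z) (at 0)"
    by (rule stiefel_curve[OF V Z]) blast
  define c where "c t = (b t, x + t *\<^sub>R y, d t)" for t
  have "smooth_curve_on c UNIV"
    unfolding c_def by (intro smooth_curve_on_Pair smooth_curve_on_affine b d)
  then have "smooth_curve_on c {-1<..<1}"
    by (auto simp: smooth_curve_on_def)
  then have curve: "c \<in> curves_through param_mfd p"
    using b d by (auto simp: curves_through_def c_def p_eq param_mfd_def intro!: exI[of _ 1])
  have "((\<lambda>t. x + t *\<^sub>R y) has_vector_derivative y) (at 0)"
    by (auto intro!: derivative_eq_intros)
  then have "(c has_vector_derivative w) (at 0)"
    unfolding c_def w_eq by (intro has_vector_derivative_Pair b d)
  then show ?thesis
    unfolding tangent_space_def using curve vector_derivative_at by blast
qed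

text \<open>For \<open>U\<close> in the Stiefel manifold this is the orthogonal projection onto the
  tangent space: U times the symmetric part of U^T Y is removed. Being polynomial in both arguments
  and defined off the manifold, it inherits Lipschitz bounds by algebra.\<close>

definition proj_stiefel :: "real ^ 'k ^ 'm \<Rightarrow> real ^ 'k ^ 'm \<Rightarrow> real ^ 'k ^ 'm" where
  "proj_stiefel U Y = Y - (1 / 2) *\<^sub>R (U ** (transpose U ** Y + transpose Y ** U))"

definition proj_mfd ::
  "('m::finite, 'k::finite, 'n::finite) triple \<Rightarrow> ('m, 'k, 'n) triple \<Rightarrow> ('m, 'k, 'n) triple" where
  "proj_mfd p E =
     (proj_stiefel (fst p) (fst E), fst (snd E), proj_stiefel (snd (snd p)) (snd (snd E)))"

lemma proj_stiefel_tangent: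
  assumes "U \<in> stiefel"
  shows "proj_stiefel U Y \<in> stiefel_tangent U"
proof -
  define S where "S = transpose U ** Y + transpose Y ** U"
  have S: "transpose S = S"
    by (simp add: S_def transpose_add matrix_transpose_mul add.commute)
  have UU: "transpose U ** U = mat 1"
    using assms by (simp add: stiefel_def)
  have "transpose U ** (Y - (1 / 2) *\<^sub>R (U ** S)) = transpose U ** Y - (1 / 2) *\<^sub>R S"
    by (simp add: matrix_mult_bilinear_simps matrix_mul_assoc UU)
  moreover have "transpose (Y - (1 / 2) *\<^sub>R (U ** S)) ** U = transpose Y ** U - (1 / 2) *\<^sub>R S"
    by (simp add: transpose_diff transpose_scalar matrix_transpose_mul matrix_mult_bilinear_simps S
        matrix_mul_assoc[symmetric] UU)
  \<comment> \<open>Each of the two summands loses half of \<open>S\<close>, and their original sum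
    is \<open>S\<close>.\<close>
  moreover have "transpose U ** Y - (1 / 2) *\<^sub>R S + (transpose Y ** U - (1 / 2) *\<^sub>R S) = 0"
  proof -
    have "S = (1 / 2) *\<^sub>R S + (1 / 2) *\<^sub>R S"
      by (simp add: scaleR_add_left[symmetric])
    moreover have "transpose U ** Y - H + (transpose Y ** U - H) = S - (H + H)" for H
      by (simp add: S_def)
    ultimately show ?thesis by simp
  qed
  ultimately show ?thesis
    by (simp only: stiefel_tangent_def proj_stiefel_def S_def[symmetric] mem_Collect_eq)
qed

lemma inner_transpose: "transpose A \<bullet> transpose B = A \<bullet> (B :: real ^ 'k ^ 'm)"
  unfolding inner_vec_def transpose_def by simp (rule sum.swap)

lemma inner_matrix_mult_left:
  "(U ** S) \<bullet> Z = S \<bullet> (transpose (U :: real ^ 'k ^ 'm) ** (Z :: real ^ 'l ^ 'm))"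
proof -
  have "(U ** S) \<bullet> Z = (\<Sum>i\<in>UNIV. \<Sum>j\<in>UNIV. \<Sum>l\<in>UNIV. U $ i $ l * S $ l $ j * Z $ i $ j)"
    by (simp add: inner_vec_def matrix_matrix_mult_def sum_distrib_right)
  also have "\<dots> = (\<Sum>i\<in>UNIV. \<Sum>l\<in>UNIV. \<Sum>j\<in>UNIV. U $ i $ l * S $ l $ j * Z $ i $ j)"
    by (intro sum.cong refl sum.swap)
  also have "\<dots> = (\<Sum>l\<in>UNIV. \<Sum>i\<in>UNIV. \<Sum>j\<in>UNIV. U $ i $ l * S $ l $ j * Z $ i $ j)"
    by (rule sum.swap)
  also have "\<dots> = (\<Sum>l\<in>UNIV. \<Sum>j\<in>UNIV. \<Sum>i\<in>UNIV. U $ i $ l * S $ l $ j * Z $ i $ j)"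
    by (intro sum.cong refl sum.swap)
  also have "\<dots> = S \<bullet> (transpose U ** Z)"
    by (simp add: inner_vec_def matrix_matrix_mult_def transpose_def sum_distrib_left mult_ac)
  finally show ?thesis .
qed

text \<open>The removed component is normal: it pairs a symmetric with a skew matrix.\<close>

lemma inner_proj_stiefel:
  assumes "Z \<in> stiefel_tangent U"
  shows "proj_stiefel U Y \<bullet> Z = Y \<bullet> Z"
proof -
  define S where "S = transpose U ** Y + transpose Y ** U"
  have S: "transpose S = S"
    by (simp add: S_def transpose_add matrix_transpose_mul add.commute)
  have skew: "transpose (transpose U ** Z) = - (transpose U ** Z)"
    using assms by (simp add: stiefel_tangent_def matrix_transpose_mul eq_neg_iff_add_eq_0 add.commute)
  have "S \<bullet> (transpose U ** Z) = transpose S \<bullet> transpose (transpose U ** Z)"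
    by (simp only: inner_transpose)
  then have "S \<bullet> (transpose U ** Z) = 0"
    unfolding S skew by simp
  then show ?thesis
    by (simp add: proj_stiefel_def S_def[symmetric] inner_diff_left inner_matrix_mult_left)
qed

lemma proj_mfd_tangent: "p \<in> param_mfd \<Longrightarrow> proj_mfd p E \<in> mfd_tangent p"
  by (auto simp: proj_mfd_def mfd_tangent_def param_mfd_def intro!: proj_stiefel_tangent)

lemma inner_proj_mfd: "w \<in> mfd_tangent p \<Longrightarrow> proj_mfd p E \<bullet> w = E \<bullet> w"
  by (cases E, cases w) (auto simp: proj_mfd_def mfd_tangent_def inner_proj_stiefel)

text \<open>Along curves in the manifold \<open>f\<close> and \<open>g\<close> coincide, and
  projecting \<open>E\<close> does not change its inner products with tangent vectors. So any
  differentiable extension may be used, in particular one simpler than the original formula.\<close>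

lemma riemannian_gradient_param_mfd:
  fixes p :: "('m::finite, 'k::finite, 'n::finite) triple"
  assumes p: "p \<in> param_mfd" and f: "(f has_derivative (\<lambda>w. E \<bullet> w)) (at p)"
    and g: "\<And>q. q \<in> param_mfd \<Longrightarrow> g q = f q"
  shows "riemannian_gradient param_mfd g p = proj_mfd p E"
proof -
  have "is_riemannian_gradient param_mfd g p (proj_mfd p E)"
    unfolding is_riemannian_gradient_def
  proof (intro conjI ballI)
    show "proj_mfd p E \<in> tangent_space param_mfd p"
      using p proj_mfd_tangent mfd_tangent_subset_tangent_space by blast
    fix c assume c: "c \<in> curves_through param_mfd p"
    let ?w = "vector_derivative c (at 0)"
    obtain \<delta> where \<delta>: "0 < \<delta>" "c ` {-\<delta><..<\<delta>} \<subseteq> param_mfd" and c0: "c 0 = p"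
      using c by (auto simp: curves_through_def)
    have "(c has_derivative (\<lambda>s. s *\<^sub>R ?w)) (at 0)"
      using curves_through_has_vector_derivative[OF c] by (simp add: has_vector_derivative_def)
    then have "((\<lambda>t. f (c t)) has_derivative (\<lambda>s. E \<bullet> (s *\<^sub>R ?w))) (at 0)"
      by (rule has_derivative_compose) (simp add: c0 f)
    then have "((\<lambda>t. f (c t)) has_real_derivative (proj_mfd p E \<bullet> ?w)) (at 0)"
      by (simp add: has_field_derivative_def mult.commute[of _ "E \<bullet> ?w"]
          inner_proj_mfd[OF curves_through_param_mfd_tangent[OF c]])
    moreover have on_mfd: "c t \<in> param_mfd" if "t \<in> {-\<delta><..<\<delta>}" for t
      using \<delta>(2) that by blast
    ultimately show "((\<lambda>t. g (c t)) has_real_derivative (proj_mfd p E \<bullet> ?w)) (at 0)"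
      by (elim has_field_derivative_transform_within_open[where S = "{-\<delta><..<\<delta>}"])
        (use \<delta> on_mfd in \<open>auto simp: g\<close>)
  qed
  then show ?thesis
    unfolding riemannian_gradient_def
    by (intro the_equality) (auto intro: is_riemannian_gradient_unique)
qed

section \<open>Descent along the retraction\<close>

text \<open>Globally Lipschitz maps are not closed under products. This class is closed under
  bounded bilinear maps, so polynomial gradients belong to it by algebraic rules, without second
  derivatives.\<close>

definition lipschitz_on_balls :: "('a::real_normed_vector \<Rightarrow> 'b::real_normed_vector) \<Rightarrow> bool" where
  "lipschitz_on_balls f \<longleftrightarrow>
     (\<forall>r. \<exists>L. \<forall>p\<in>cball 0 r. \<forall>q\<in>cball 0 r. norm (f p - f q) \<le> L * norm (p - q))"

lemma lipschitz_on_ballsD: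
  assumes "lipschitz_on_balls f"
  obtains L where "0 \<le> L" "\<And>p q. p \<in> cball 0 r \<Longrightarrow> q \<in> cball 0 r \<Longrightarrow> norm (f p - f q) \<le> L * norm (p - q)"
proof -
  obtain L where L: "\<And>p q. p \<in> cball 0 r \<Longrightarrow> q \<in> cball 0 r \<Longrightarrow> norm (f p - f q) \<le> L * norm (p - q)"
    using assms unfolding lipschitz_on_balls_def by meson
  show ?thesis
    by (rule that[of "\<bar>L\<bar>"]) (auto intro!: order_trans[OF L mult_right_mono[OF abs_ge_self]])
qed

lemma lipschitz_on_balls_bounded:
  assumes "lipschitz_on_balls f"
  obtains B where "0 \<le> B" "\<And>p. p \<in> cball 0 r \<Longrightarrow> norm (f p) \<le> B"
proof -
  obtain L where L: "0 \<le> L" "\<And>p q. p \<in> cball 0 r \<Longrightarrow> q \<in> cball 0 r \<Longrightarrow> norm (f p - f q) \<le> L * norm (p - q)"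
    using lipschitz_on_ballsD[OF assms, of r] by blast
  show ?thesis
  proof (rule that[of "L * \<bar>r\<bar> + norm (f 0)"])
    fix p :: 'a assume p: "p \<in> cball 0 r"
    then have r: "norm p \<le> r" by simp
    then have "0 \<le> r" using norm_ge_zero[of p] by linarith
    then have "norm (f p - f 0) \<le> L * norm p"
      using L(2)[OF p, of 0] by simp
    also have "\<dots> \<le> L * \<bar>r\<bar>"
      using L(1) r by (intro mult_left_mono) auto
    finally show "norm (f p) \<le> L * \<bar>r\<bar> + norm (f 0)"
      using norm_triangle_ineq2[of "f p" "f 0"] by linarith
  qed (use L in auto)
qed

lemma lipschitz_on_balls_bounded_linear:
  assumes "bounded_linear f"
  shows "lipschitz_on_balls f"
proof -
  obtain K where "\<And>v. norm (f v) \<le> norm v * K"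
    using bounded_linear.bounded[OF assms] by blast
  then have "norm (f p - f q) \<le> K * norm (p - q)" for p q
    by (metis linear_diff[OF bounded_linear.linear[OF assms]] mult.commute)
  then show ?thesis
    unfolding lipschitz_on_balls_def by blast
qed

lemma lipschitz_on_balls_const: "lipschitz_on_balls (\<lambda>_. c)"
  unfolding lipschitz_on_balls_def by (intro allI exI[of _ 0]) simp

lemma lipschitz_on_balls_compose_bounded_linear:
  assumes h: "bounded_linear h" and f: "lipschitz_on_balls f"
  shows "lipschitz_on_balls (\<lambda>p. h (f p))"
  unfolding lipschitz_on_balls_def
proof
  fix r
  obtain K where K: "0 \<le> K" "\<And>v. norm (h v) \<le> norm v * K"
    using bounded_linear.nonneg_bounded[OF h] by blast
  obtain L where L: "\<And>p q. p \<in> cball 0 r \<Longrightarrow> q \<in> cball 0 r \<Longrightarrow> norm (f p - f q) \<le> L * norm (p - q)"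
    using lipschitz_on_ballsD[OF f] by metis
  have "norm (h (f p) - h (f q)) \<le> (L * K) * norm (p - q)" if "p \<in> cball 0 r" "q \<in> cball 0 r" for p q
  proof -
    have "norm (h (f p) - h (f q)) \<le> norm (f p - f q) * K"
      using K(2)[of "f p - f q"] by (simp add: linear_diff[OF bounded_linear.linear[OF h]])
    also have "\<dots> \<le> L * norm (p - q) * K"
      using L[OF that] K(1) by (rule mult_right_mono)
    finally show ?thesis by (simp add: mult_ac)
  qed
  then show "\<exists>L. \<forall>p\<in>cball 0 r. \<forall>q\<in>cball 0 r. norm (h (f p) - h (f q)) \<le> L * norm (p - q)"
    by blast
qed

lemma lipschitz_on_balls_add:
  assumes f: "lipschitz_on_balls f" and g: "lipschitz_on_balls g"
  shows "lipschitz_on_balls (\<lambda>p. f p + g p)"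
  unfolding lipschitz_on_balls_def
proof
  fix r
  obtain L where L: "\<And>p q. p \<in> cball 0 r \<Longrightarrow> q \<in> cball 0 r \<Longrightarrow> norm (f p - f q) \<le> L * norm (p - q)"
    using lipschitz_on_ballsD[OF f] by metis
  obtain N where N: "\<And>p q. p \<in> cball 0 r \<Longrightarrow> q \<in> cball 0 r \<Longrightarrow> norm (g p - g q) \<le> N * norm (p - q)"
    using lipschitz_on_ballsD[OF g] by metis
  have "norm ((f p + g p) - (f q + g q)) \<le> (L + N) * norm (p - q)"
    if "p \<in> cball 0 r" "q \<in> cball 0 r" for p q
    using norm_triangle_ineq[of "f p - f q" "g p - g q"] L[OF that] N[OF that]
    by (simp add: algebra_simps)
  then show "\<exists>L. \<forall>p\<in>cball 0 r. \<forall>q\<in>cball 0 r. norm ((f p + g p) - (f q + g q)) \<le> L * norm (p - q)"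
    by blast
qed

lemma lipschitz_on_balls_bilinear:
  assumes h: "bounded_bilinear h" and f: "lipschitz_on_balls f" and g: "lipschitz_on_balls g"
  shows "lipschitz_on_balls (\<lambda>p. h (f p) (g p))"
  unfolding lipschitz_on_balls_def
proof
  fix r
  obtain K where K: "0 \<le> K" "\<And>a b. norm (h a b) \<le> norm a * norm b * K"
    using bounded_bilinear.nonneg_bounded[OF h] by blast
  obtain L where L: "0 \<le> L" "\<And>p q. p \<in> cball 0 r \<Longrightarrow> q \<in> cball 0 r \<Longrightarrow> norm (f p - f q) \<le> L * norm (p - q)"
    using lipschitz_on_ballsD[OF f] by metis
  obtain N where N: "0 \<le> N" "\<And>p q. p \<in> cball 0 r \<Longrightarrow> q \<in> cball 0 r \<Longrightarrow> norm (g p - g q) \<le> N * norm (p - q)"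
    using lipschitz_on_ballsD[OF g] by metis
  obtain A where A: "0 \<le> A" "\<And>p. p \<in> cball 0 r \<Longrightarrow> norm (f p) \<le> A"
    using lipschitz_on_balls_bounded[OF f] by metis
  obtain B where B: "0 \<le> B" "\<And>p. p \<in> cball 0 r \<Longrightarrow> norm (g p) \<le> B"
    using lipschitz_on_balls_bounded[OF g] by metis
  have "norm (h (f p) (g p) - h (f q) (g q)) \<le> (L * B * K + A * N * K) * norm (p - q)"
    if p: "p \<in> cball 0 r" and q: "q \<in> cball 0 r" for p q
  proof -
    have "h (f p) (g p) - h (f q) (g q) = h (f p - f q) (g p) + h (f q) (g p - g q)"
      by (simp add: bounded_bilinear.diff_left[OF h] bounded_bilinear.diff_right[OF h])
    then have "norm (h (f p) (g p) - h (f q) (g q)) \<le> norm (h (f p - f q) (g p)) + norm (h (f q) (g p - g q))"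
      by (simp add: norm_triangle_ineq)
    also have "\<dots> \<le> norm (f p - f q) * norm (g p) * K + norm (f q) * norm (g p - g q) * K"
      by (intro add_mono K)
    also have "\<dots> \<le> (L * norm (p - q)) * B * K + A * (N * norm (p - q)) * K"
      using K(1) L N A B p q by (intro add_mono mult_right_mono mult_mono) auto
    finally show ?thesis by (simp add: algebra_simps)
  qed
  then show "\<exists>L. \<forall>p\<in>cball 0 r. \<forall>q\<in>cball 0 r. norm (h (f p) (g p) - h (f q) (g q)) \<le> L * norm (p - q)"
    by blast
qed

lemma lipschitz_on_balls_sum:
  assumes "\<And>i. i \<in> I \<Longrightarrow> lipschitz_on_balls (f i)"
  shows "lipschitz_on_balls (\<lambda>p. \<Sum>i\<in>I. f i p)"
  using assms
proof (induction I rule: infinite_finite_induct)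
  case (insert i I)
  then show ?case
    by (simp add: lipschitz_on_balls_add)
qed (simp_all add: lipschitz_on_balls_const)

lemma lipschitz_on_balls_diff:
  assumes f: "lipschitz_on_balls f" and g: "lipschitz_on_balls g"
  shows "lipschitz_on_balls (\<lambda>p. f p - g p)"
  using lipschitz_on_balls_add[OF f lipschitz_on_balls_compose_bounded_linear[OF
        bounded_linear_minus[OF bounded_linear_ident] g]] by simp

lemma lipschitz_on_balls_Pair:
  assumes f: "lipschitz_on_balls f" and g: "lipschitz_on_balls g"
  shows "lipschitz_on_balls (\<lambda>p. (f p, g p))"
proof -
  have "bounded_linear (\<lambda>a :: 'b. (a, 0 :: 'c))" "bounded_linear (\<lambda>b :: 'c. (0 :: 'b, b))"
    by (intro bounded_linear_Pair bounded_linear_ident bounded_linear_zero)+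
  from lipschitz_on_balls_add[OF lipschitz_on_balls_compose_bounded_linear[OF this(1) f]
      lipschitz_on_balls_compose_bounded_linear[OF this(2) g]]
  show ?thesis by simp
qed

lemma lipschitz_on_balls_continuous:
  assumes "lipschitz_on_balls f"
  shows "continuous_on UNIV f"
proof -
  have "isCont f p" for p
  proof -
    obtain L where L: "0 \<le> L" "\<And>q q'. q \<in> cball 0 (norm p + 1) \<Longrightarrow> q' \<in> cball 0 (norm p + 1)
        \<Longrightarrow> norm (f q - f q') \<le> L * norm (q - q')"
      using lipschitz_on_ballsD[OF assms] by metis
    have near: "eventually (\<lambda>q. q \<in> ball p 1) (at p)"
      by (rule eventually_at_in_open') auto
    have "eventually (\<lambda>q. norm (f q - f p) \<le> L * norm (q - p)) (at p)"
      using near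
    proof eventually_elim
      case (elim q)
      then have "norm q \<le> norm p + 1"
        using norm_triangle_ineq2[of q p] by (simp add: dist_norm norm_minus_commute)
      then show ?case by (intro L) auto
    qed
    moreover have "((\<lambda>q. L * norm (q - p)) \<longlongrightarrow> L * norm (p - p)) (at p)"
      by (intro tendsto_intros)
    then have "((\<lambda>q. L * norm (q - p)) \<longlongrightarrow> 0) (at p)"
      by simp
    ultimately have "((\<lambda>q. f q - f p) \<longlongrightarrow> 0) (at p)"
      by (rule Lim_null_comparison)
    then show ?thesis
      by (simp add: isCont_def LIM_zero_iff)
  qed
  then show ?thesis
    by (simp add: continuous_on_eq_continuous_at)
qed

text \<open>Mean value theorem on the segment from \<open>p\<close> to \<open>q\<close>, comparing
  the gradient at the intermediate point with that at \<open>p\<close>.\<close>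

lemma descent_inequality:
  fixes f :: "'a::euclidean_space \<Rightarrow> real"
  assumes f: "\<And>p. (f has_derivative (\<lambda>w. E p \<bullet> w)) (at p)" and E: "lipschitz_on_balls E"
  obtains L where "0 \<le> L" "\<And>p q. p \<in> cball 0 r \<Longrightarrow> q \<in> cball 0 r \<Longrightarrow>
    f q \<le> f p + E p \<bullet> (q - p) + L * (norm (q - p))\<^sup>2"
proof -
  obtain L where L: "0 \<le> L" "\<And>p q. p \<in> cball 0 r \<Longrightarrow> q \<in> cball 0 r \<Longrightarrow> norm (E p - E q) \<le> L * norm (p - q)"
    using lipschitz_on_ballsD[OF E] by metis
  show ?thesis
  proof (rule that[OF L(1)])
    fix p q :: 'a assume p: "p \<in> cball 0 r" and q: "q \<in> cball 0 r"
    define x where "x t = p + t *\<^sub>R (q - p)" for t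
    have "((\<lambda>t. f (x t)) has_real_derivative E (x t) \<bullet> (q - p)) (at t)" for t
    proof -
      have "(x has_derivative (\<lambda>s. s *\<^sub>R (q - p))) (at t)"
        unfolding x_def by (auto intro!: derivative_eq_intros)
      then have "((\<lambda>t. f (x t)) has_derivative (\<lambda>s. E (x t) \<bullet> (s *\<^sub>R (q - p)))) (at t)"
        by (rule has_derivative_compose) (rule f)
      then show ?thesis
        by (simp add: has_field_derivative_def mult.commute[of _ "E (x t) \<bullet> (q - p)"])
    qed
    then obtain t where t: "0 < t" "t < 1" and eq: "f (x 1) - f (x 0) = E (x t) \<bullet> (q - p)"
      using MVT2[of 0 1 "\<lambda>t. f (x t)" "\<lambda>t. E (x t) \<bullet> (q - p)"] by auto
    \<comment> \<open>Convexity of the ball keeps the intermediate point where the Lipschitz bound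
      is valid; the manifold has no such property.\<close>
    have "x t = (1 - t) *\<^sub>R p + t *\<^sub>R q"
      by (simp add: x_def algebra_simps)
    also have "\<dots> \<in> cball 0 r"
      using t by (intro convexD[OF convex_cball p q]) auto
    finally have xt: "x t \<in> cball 0 r" .
    have "(E (x t) - E p) \<bullet> (q - p) \<le> norm (E (x t) - E p) * norm (q - p)"
      by (rule norm_cauchy_schwarz)
    also have "\<dots> \<le> (L * norm (x t - p)) * norm (q - p)"
      using L(2)[OF xt p] by (intro mult_right_mono) auto
    also have "\<dots> \<le> (L * norm (q - p)) * norm (q - p)"
      using t L(1) by (intro mult_right_mono mult_left_mono) (auto simp: x_def mult_left_le_one_le)
    finally show "f q \<le> f p + E p \<bullet> (q - p) + L * (norm (q - p))\<^sup>2"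
      using eq by (simp add: x_def inner_diff_left power2_eq_square mult_ac)
  qed
qed

section \<open>The retraction on the product manifold\<close>

lemma retract_param_mfd:
  fixes p :: "('m::finite, 'k::{finite,linorder}, 'n::finite) triple"
  assumes p: "p \<in> param_mfd" and w: "w \<in> mfd_tangent p"
  shows "retract p w \<in> param_mfd"
    and "norm (retract p w - (p + w)) \<le> 2 * (real CARD('k))\<^sup>2 * (norm w)\<^sup>2"
proof -
  obtain U x V where p_eq: "p = (U, x, V)" by (cases p)
  obtain Y y Z where w_eq: "w = (Y, y, Z)" by (cases w)
  have U: "U \<in> stiefel" and V: "V \<in> stiefel"
    and Y: "transpose U ** Y + transpose Y ** U = 0" and Z: "transpose V ** Z + transpose Z ** V = 0"
    using p w by (auto simp: p_eq w_eq param_mfd_def mfd_tangent_def stiefel_tangent_def)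
  note qU = qf_stiefel_plus_tangent[OF U Y] and qV = qf_stiefel_plus_tangent[OF V Z]
  show "retract p w \<in> param_mfd"
    using qU(1) qV(1) by (simp add: p_eq w_eq param_mfd_def)
  have "norm (retract p w - (p + w)) = norm (qf (U + Y) - (U + Y), 0 :: real ^ ('k::{finite,linorder}), qf (V + Z) - (V + Z))"
    by (simp add: p_eq w_eq)
  also have "\<dots> \<le> norm (qf (U + Y) - (U + Y)) + norm (qf (V + Z) - (V + Z))"
    using norm_Pair_le[of "qf (U + Y) - (U + Y)" "(0 :: real ^ ('k::{finite,linorder}), qf (V + Z) - (V + Z))"]
    by (simp add: norm_Pair)
  also have "\<dots> \<le> 2 * (real CARD('k))\<^sup>2 * (norm Y)\<^sup>2 + 2 * (real CARD('k))\<^sup>2 * (norm Z)\<^sup>2"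
    by (intro add_mono qU qV)
  also have "\<dots> = 2 * (real CARD('k))\<^sup>2 * ((norm Y)\<^sup>2 + (norm Z)\<^sup>2)"
    by (simp add: distrib_left)
  also have "\<dots> \<le> 2 * (real CARD('k))\<^sup>2 * (norm w)\<^sup>2"
    by (intro mult_left_mono) (auto simp: w_eq norm_Pair)
  finally show "norm (retract p w - (p + w)) \<le> 2 * (real CARD('k))\<^sup>2 * (norm w)\<^sup>2" .
qed

lemma norm_retract_diff_le:
  fixes p :: "('m::finite, 'k::{finite,linorder}, 'n::finite) triple"
  assumes "p \<in> param_mfd" "w \<in> mfd_tangent p" "norm w \<le> \<rho>"
  shows "norm (retract p w - p) \<le> (1 + 2 * (real CARD('k))\<^sup>2 * \<rho>) * norm w"
proof -
  have "norm (retract p w - p) \<le> norm w + norm (retract p w - (p + w))"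
    using norm_triangle_ineq[of w "retract p w - (p + w)"] by (simp add: algebra_simps)
  also have "\<dots> \<le> norm w + 2 * (real CARD('k))\<^sup>2 * (norm w)\<^sup>2"
    using retract_param_mfd(2)[OF assms(1,2)] by simp
  also have "\<dots> \<le> norm w + 2 * (real CARD('k))\<^sup>2 * (\<rho> * norm w)"
    unfolding power2_eq_square[of "norm w"] using assms(3)
    by (intro add_left_mono mult_left_mono mult_right_mono) auto
  finally show ?thesis by (simp add: algebra_simps)
qed

text \<open>The displacement \<open>retract p w - p\<close> is \<open>w\<close> plus a second-order
  error, so the Euclidean descent inequality survives with a larger quadratic constant. The cap
  \<open>\<rho>\<close> on |w| makes that constant uniform.\<close>

lemma retract_descent:
  fixes f :: "('m::finite, 'k::{finite,linorder}, 'n::finite) triple \<Rightarrow> real"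
  assumes f: "\<And>p. (f has_derivative (\<lambda>w. E p \<bullet> w)) (at p)" and E: "lipschitz_on_balls E"
    and \<rho>: "0 \<le> \<rho>"
  obtains C where "0 \<le> C" "\<And>p w. \<lbrakk>p \<in> param_mfd; w \<in> mfd_tangent p; norm w \<le> \<rho>;
    p \<in> cball 0 r; retract p w \<in> cball 0 r\<rbrakk> \<Longrightarrow>
    f (retract p w) \<le> f p + E p \<bullet> w + C * (norm w)\<^sup>2"
proof -
  obtain L where L: "0 \<le> L" "\<And>p q. p \<in> cball 0 r \<Longrightarrow> q \<in> cball 0 r \<Longrightarrow>
      f q \<le> f p + E p \<bullet> (q - p) + L * (norm (q - p))\<^sup>2"
    using descent_inequality[OF f E] by metis
  obtain B where B: "0 \<le> B" "\<And>p. p \<in> cball 0 r \<Longrightarrow> norm (E p) \<le> B"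
    using lipschitz_on_balls_bounded[OF E] by metis
  define c where "c = 2 * (real CARD('k))\<^sup>2"
  have c: "0 \<le> c" by (simp add: c_def)
  show ?thesis
  \<comment> \<open>\<open>B * c\<close> pays for the retraction error paired with the gradient, the
    second summand for the squared displacement.\<close>
  proof (rule that[of "B * c + L * (1 + c * \<rho>)\<^sup>2"])
    show "0 \<le> B * c + L * (1 + c * \<rho>)\<^sup>2"
      using B L c by simp
  next
    fix p w :: "('m, 'k, 'n) triple"
    assume p: "p \<in> param_mfd" "p \<in> cball 0 r" and w: "w \<in> mfd_tangent p" "norm w \<le> \<rho>"
      and q: "retract p w \<in> cball 0 r"
    let ?q = "retract p w"
    have "E p \<bullet> (?q - p) = E p \<bullet> w + E p \<bullet> (?q - (p + w))"
      by (simp add: inner_diff_right inner_add_right)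
    also have "E p \<bullet> (?q - (p + w)) \<le> norm (E p) * norm (?q - (p + w))"
      by (rule norm_cauchy_schwarz)
    also have "\<dots> \<le> B * (c * (norm w)\<^sup>2)"
      using B p retract_param_mfd(2)[OF p(1) w(1)] by (intro mult_mono) (auto simp: c_def)
    finally have 1: "E p \<bullet> (?q - p) \<le> E p \<bullet> w + B * (c * (norm w)\<^sup>2)" by simp
    have "(norm (?q - p))\<^sup>2 \<le> ((1 + c * \<rho>) * norm w)\<^sup>2"
      using norm_retract_diff_le[OF p(1) w] by (intro power_mono) (auto simp: c_def)
    then have "L * (norm (?q - p))\<^sup>2 \<le> L * ((1 + c * \<rho>)\<^sup>2 * (norm w)\<^sup>2)"
      using L(1) by (intro mult_left_mono) (auto simp: power_mult_distrib)
    with 1 L(2)[OF p(2) q]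
    have "f ?q \<le> f p + (E p \<bullet> w + B * (c * (norm w)\<^sup>2)) + L * ((1 + c * \<rho>)\<^sup>2 * (norm w)\<^sup>2)"
      by linarith
    then show "f ?q \<le> f p + E p \<bullet> w + (B * c + L * (1 + c * \<rho>)\<^sup>2) * (norm w)\<^sup>2"
      by (simp add: distrib_right mult.assoc)
  qed
qed

section \<open>Adaptive stochastic gradient steps\<close>

text \<open>The left side is a rectangle below the graph of t^-(1+d) over [x, y]; the comparison
  with the integral is made by the mean value theorem for t^-d.\<close>

lemma powr_telescope_le:
  fixes x y d :: real
  assumes "0 < x" "x \<le> y" "0 < d"
  shows "(y - x) / y powr (1 + d) \<le> (x powr - d - y powr - d) / d"
proof (cases "x = y")
  case False
  with assms have xy: "x < y" by simp
  have "((\<lambda>t. t powr - d) has_real_derivative - d * t powr (- d - 1)) (at t)" if "x \<le> t" for t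
    using that assms by (auto intro!: derivative_eq_intros simp: powr_diff divide_simps)
  then obtain t where t: "x < t" "t < y"
    and eq: "y powr - d - x powr - d = (y - x) * (- d * t powr (- d - 1))"
    using MVT2[OF xy, of "\<lambda>t. t powr - d" "\<lambda>t. - d * t powr (- d - 1)"] by blast
  have "(y - x) / y powr (1 + d) = (y - x) * y powr (- d - 1)"
  proof -
    have "- d - 1 = - (1 + d)" by simp
    then show ?thesis by (simp only: powr_minus_divide) simp
  qed
  also have "\<dots> \<le> (y - x) * t powr (- d - 1)"
    using t assms by (intro mult_left_mono powr_mono2') auto
  also have "\<dots> = (x powr - d - y powr - d) / d"
    using eq assms by (simp add: field_simps)
  finally show ?thesis .
qed simp

text \<open>The denominator at time \<open>t\<close> does not yet contain \<open>q t\<close>,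
  whereas \<open>powr_telescope_le\<close> asks for the next one. As the increments are at most
  \<open>B\<close>, consecutive partial sums have ratio at most 1 + B / \<beta>, whence the leading
  constant; the rest telescopes, uniformly in \<open>T\<close>.\<close>

lemma adaptive_sum_bound:
  fixes q :: "nat \<Rightarrow> real"
  assumes "0 < \<beta>" "0 < d" "\<And>t. 0 \<le> q t" "\<And>t. q t \<le> B"
  shows "(\<Sum>t<T. q t / (\<beta> + (\<Sum>s<t. q s)) powr (1 + d))
    \<le> (1 + B / \<beta>) powr (1 + d) * (\<beta> powr - d / d)"
proof -
  define S where "S t = \<beta> + (\<Sum>s<t. q s)" for t
  have S: "\<beta> \<le> S t" for t
    unfolding S_def using assms(3) by (simp add: sum_nonneg)
  have Sp: "0 < S t" for t
    using S[of t] assms(1) by linarith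
  have B: "0 \<le> B"
    using assms(3,4)[of 0] by linarith
  define c where "c = 1 + B / \<beta>"
  have c: "1 \<le> c"
    unfolding c_def using B assms(1) by simp
  have "q t / S t powr (1 + d) \<le> c powr (1 + d) * ((S t powr - d - S (Suc t) powr - d) / d)" for t
  proof -
    have Suc: "S (Suc t) = S t + q t"
      by (simp add: S_def)
    have "q t \<le> B / \<beta> * S t"
      using assms(1) S[of t] assms(4)[of t] B
      by (smt (verit, best) divide_pos_pos mult_left_mono nonzero_eq_divide_eq divide_nonneg_nonneg)
    then have "S (Suc t) \<le> c * S t"
      by (simp add: Suc c_def algebra_simps)
    then have "S (Suc t) powr (1 + d) \<le> c powr (1 + d) * S t powr (1 + d)"
      using Sp[of t] Sp[of "Suc t"] c assms(2)
      by (subst powr_mult[symmetric]) (auto intro!: powr_mono2)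
    then have "q t / S t powr (1 + d) \<le> c powr (1 + d) * (q t / S (Suc t) powr (1 + d))"
      using Sp[of t] Sp[of "Suc t"] assms(3)[of t]
      by (simp add: divide_simps) (metis mult.commute mult.left_commute mult_left_mono)
    also have "q t / S (Suc t) powr (1 + d) \<le> (S t powr - d - S (Suc t) powr - d) / d"
      using powr_telescope_le[of "S t" "S (Suc t)" d] Sp[of t] assms(2) assms(3)[of t] Suc by simp
    finally show ?thesis
      using c by (simp add: mult_left_mono)
  qed
  then have "(\<Sum>t<T. q t / S t powr (1 + d))
      \<le> (\<Sum>t<T. c powr (1 + d) * ((S t powr - d - S (Suc t) powr - d) / d))"
    by (intro sum_mono)
  also have "\<dots> = c powr (1 + d) * ((S 0 powr - d - S T powr - d) / d)"
    by (simp add: sum_distrib_left[symmetric] sum_divide_distrib[symmetric]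
        sum_lessThan_telescope'[where f = "\<lambda>t. S t powr - d"])
  also have "\<dots> \<le> c powr (1 + d) * (\<beta> powr - d / d)"
    using assms(2) by (intro mult_left_mono divide_right_mono) (auto simp: S_def)
  finally show ?thesis
    by (simp add: S_def c_def)
qed

text \<open>The left side is the cofactor of y in (x + y)^3 - x^3. Removing the mixed term leaves
  only products that are summable in the application.\<close>

lemma sum_cubic_cofactor_le:
  fixes x y :: real
  shows "(x + y)\<^sup>2 + (x + y) * x + x\<^sup>2 \<le> 5 * x\<^sup>2 + 3 * y\<^sup>2"
proof -
  have "5 * x\<^sup>2 + 3 * y\<^sup>2 - ((x + y)\<^sup>2 + (x + y) * x + x\<^sup>2) = (3 * (x - y)\<^sup>2 + x\<^sup>2 + y\<^sup>2) / 2"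
    by (simp add: power2_eq_square algebra_simps)
  moreover have "0 \<le> (3 * (x - y)\<^sup>2 + x\<^sup>2 + y\<^sup>2) / 2"
    by simp
  ultimately show ?thesis
    by (metis diff_ge_0_iff_ge)
qed

text \<open>
  The cubes \<open>b t ^ 3\<close> have summable increments, so \<open>b\<close> converges; its limit must vanish because
  the weights \<open>e t\<close> dominate the harmonic series.
\<close>

lemma LIMSEQ_zero_of_weighted_square_summable:
  fixes b e q :: "nat \<Rightarrow> real"
  assumes b: "\<And>t. 0 \<le> b t" and e: "\<And>t. 0 < e t" "\<And>t. e t \<le> E"
    and q: "\<And>t. 0 \<le> q t" "\<And>t. q t \<le> Q"
    and weighted: "summable (\<lambda>t. e t * (b t)\<^sup>2)"
    and square: "summable (\<lambda>t. (e t * q t)\<^sup>2)"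
    and harmonic: "0 < c" "\<And>t. c / real (Suc t) \<le> e t"
    and incr: "\<And>t. \<bar>b (Suc t) - b t\<bar> \<le> L * (e t * q t)"
  shows "b \<longlonglongrightarrow> 0"
proof -
  have Q: "0 \<le> Q" and E: "0 \<le> E"
    using q[of 0] e[of 0] by linarith+
  have incr': "\<bar>b (Suc t) - b t\<bar> \<le> \<bar>L\<bar> * (e t * q t)" for t
    using incr[of t] e(1)[of t] q(1)[of t]
    by (smt (verit) mult_right_mono mult_nonneg_nonneg)
  \<comment> \<open>With the cube, each term carries a factor \<Delta> to spare: in front of
    \<open>(b t)\<^sup>2\<close> it gives back the weight \<open>e t\<close>, and in \<Delta>^3 one
    factor is bounded by a constant, leaving \<open>(e t * q t)\<^sup>2\<close>.\<close>
  have cube: "\<bar>b (Suc t) ^ 3 - b t ^ 3\<bar>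
      \<le> 5 * \<bar>L\<bar> * Q * (e t * (b t)\<^sup>2) + 3 * \<bar>L\<bar> ^ 3 * E * Q * (e t * q t)\<^sup>2" for t
  proof -
    define \<Delta> where "\<Delta> = \<bar>b (Suc t) - b t\<bar>"
    define x where "x = e t * q t"
    have x: "0 \<le> x" "x \<le> e t * Q" "x \<le> E * Q"
      unfolding x_def using e[of t] q[of t] E by (auto intro!: mult_left_mono mult_mono)
    have D: "0 \<le> \<Delta>" "\<Delta> \<le> \<bar>L\<bar> * x"
      unfolding \<Delta>_def x_def using incr'[of t] by auto
    have "b (Suc t) ^ 3 - b t ^ 3
        = (b (Suc t) - b t) * ((b (Suc t))\<^sup>2 + b (Suc t) * b t + (b t)\<^sup>2)"
      by (simp add: algebra_simps power2_eq_square power3_eq_cube)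
    then have "\<bar>b (Suc t) ^ 3 - b t ^ 3\<bar>
        = \<Delta> * ((b (Suc t))\<^sup>2 + b (Suc t) * b t + (b t)\<^sup>2)"
      using b[of t] b[of "Suc t"] by (simp add: abs_mult \<Delta>_def)
    also have "\<dots> \<le> \<Delta> * ((b t + \<Delta>)\<^sup>2 + (b t + \<Delta>) * b t + (b t)\<^sup>2)"
      using b[of t] b[of "Suc t"] D
      by (intro mult_left_mono add_mono power_mono mult_right_mono) (auto simp: \<Delta>_def)
    also have "\<dots> \<le> \<Delta> * (5 * (b t)\<^sup>2 + 3 * \<Delta>\<^sup>2)"
      using D by (intro mult_left_mono sum_cubic_cofactor_le) auto
    also have "\<dots> = 5 * (\<Delta> * (b t)\<^sup>2) + 3 * (\<Delta> * \<Delta>\<^sup>2)"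
      by (simp add: distrib_left)
    also have "\<dots> \<le> 5 * ((\<bar>L\<bar> * (e t * Q)) * (b t)\<^sup>2) + 3 * ((\<bar>L\<bar> * (E * Q)) * (\<bar>L\<bar> * x)\<^sup>2)"
    proof -
      have "\<Delta> \<le> \<bar>L\<bar> * (e t * Q)" "\<Delta> \<le> \<bar>L\<bar> * (E * Q)"
        using D x by (meson order_trans mult_left_mono abs_ge_zero)+
      moreover have "\<Delta>\<^sup>2 \<le> (\<bar>L\<bar> * x)\<^sup>2"
        using D by (intro power_mono)
      ultimately have "\<Delta> * (b t)\<^sup>2 \<le> (\<bar>L\<bar> * (e t * Q)) * (b t)\<^sup>2"
        "\<Delta> * \<Delta>\<^sup>2 \<le> (\<bar>L\<bar> * (E * Q)) * (\<bar>L\<bar> * x)\<^sup>2"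
        using E Q by (auto intro!: mult_mono mult_right_mono)
      then show ?thesis by linarith
    qed
    also have "\<dots> = 5 * \<bar>L\<bar> * Q * (e t * (b t)\<^sup>2) + 3 * \<bar>L\<bar> ^ 3 * E * Q * (e t * q t)\<^sup>2"
      unfolding x_def power3_eq_cube power2_eq_square by (simp only: mult_ac)
    finally show ?thesis .
  qed
  have "summable (\<lambda>t. \<bar>b (Suc t) ^ 3 - b t ^ 3\<bar>)"
    by (rule summable_comparison_test'[OF summable_add[OF
          summable_mult[OF weighted, of "5 * \<bar>L\<bar> * Q"]
          summable_mult[OF square, of "3 * \<bar>L\<bar> ^ 3 * E * Q"]], of 0])
      (use cube in simp)
  then have "summable (\<lambda>t. b (Suc t) ^ 3 - b t ^ 3)"
    by (rule summable_rabs_cancel)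
  then have "convergent (\<lambda>n. \<Sum>t<n. b (Suc t) ^ 3 - b t ^ 3)"
    by (simp add: summable_iff_convergent)
  then obtain l0 where "(\<lambda>n. b n ^ 3 - b 0 ^ 3) \<longlonglongrightarrow> l0"
    by (auto simp: convergent_def sum_lessThan_telescope[where f = "\<lambda>t. b t ^ 3"])
  then have "(\<lambda>n. b n ^ 3 - b 0 ^ 3 + b 0 ^ 3) \<longlonglongrightarrow> l0 + b 0 ^ 3"
    by (intro tendsto_intros)
  then have "(\<lambda>n. root 3 (b n ^ 3)) \<longlonglongrightarrow> root 3 (l0 + b 0 ^ 3)"
    by (intro tendsto_intros) simp
  then obtain l where l: "b \<longlonglongrightarrow> l"
    using b by (auto simp: real_root_power_cancel)
  have "l = 0"
  proof (rule ccontr)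
    assume "l \<noteq> 0"
    moreover have "0 \<le> l"
      using l b by (intro LIMSEQ_le_const) auto
    ultimately have "0 < l" by simp
    then have "eventually (\<lambda>t. l / 2 < b t) sequentially"
      using l by (intro order_tendstoD) auto
    then obtain N where N: "\<And>t. t \<ge> N \<Longrightarrow> l / 2 < b t"
      by (auto simp: eventually_sequentially)
    have "summable (\<lambda>t. c * (l / 2)\<^sup>2 * inverse (real (Suc t)))"
    proof (rule summable_comparison_test'[OF weighted, of N])
      fix t assume "N \<le> t"
      then have "(l / 2)\<^sup>2 \<le> (b t)\<^sup>2"
        using N[of t] \<open>0 < l\<close> by (intro power_mono) auto
      then have "c / real (Suc t) * (l / 2)\<^sup>2 \<le> e t * (b t)\<^sup>2"
        using harmonic e(1)[of t] by (intro mult_mono) (auto intro: less_imp_le)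
      then show "norm (c * (l / 2)\<^sup>2 * inverse (real (Suc t))) \<le> e t * (b t)\<^sup>2"
      proof -
        have "c * (l / 2)\<^sup>2 * inverse (real (Suc t)) = c / real (Suc t) * (l / 2)\<^sup>2"
          by (simp only: divide_inverse mult_ac)
        moreover have "0 \<le> c / real (Suc t) * (l / 2)\<^sup>2"
          using harmonic(1) by (intro mult_nonneg_nonneg) auto
        ultimately show ?thesis
          using \<open>c / real (Suc t) * (l / 2)\<^sup>2 \<le> e t * (b t)\<^sup>2\<close> by (simp only: real_norm_def abs_of_nonneg)
      qed
    qed
    then have "summable (\<lambda>t. inverse (real (Suc t)))"
      using \<open>0 < l\<close> harmonic(1) by (simp only: summable_cmult_iff) simp
    then show False
      using not_summable_harmonic[where 'a = real] summable_Suc_iff[of "\<lambda>n. inverse (real n)"] by simp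
  qed
  with l show ?thesis by simp
qed

section \<open>Dependence on the past and decrease in expectation\<close>

context prob_space
begin

text \<open>\<open>F\<close> picks, for each history, some outcome that realises it; its value at
  unattained histories is arbitrary.\<close>

lemma past_factors:
  fixes \<xi> :: "nat \<Rightarrow> 'a \<Rightarrow> 's" and Y :: "'a \<Rightarrow> 'b"
  assumes "\<And>\<omega> \<omega>'. \<lbrakk>\<omega> \<in> space M; \<omega>' \<in> space M; \<And>s. s < t \<Longrightarrow> \<xi> s \<omega> = \<xi> s \<omega>'\<rbrakk> \<Longrightarrow> Y \<omega> = Y \<omega>'"
  obtains F where "\<And>\<omega>. \<omega> \<in> space M \<Longrightarrow> Y \<omega> = F (restrict (\<lambda>s. \<xi> s \<omega>) {..<t})"
proof
  define P where "P h \<omega> \<longleftrightarrow> \<omega> \<in> space M \<and> restrict (\<lambda>s. \<xi> s \<omega>) {..<t} = h" for h \<omega>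
  fix \<omega> assume \<omega>: "\<omega> \<in> space M"
  let ?h = "restrict (\<lambda>s. \<xi> s \<omega>) {..<t}"
  define \<omega>' where "\<omega>' = (SOME \<omega>'. P ?h \<omega>')"
  have "P ?h \<omega>'"
    unfolding \<omega>'_def using \<omega> by (intro someI[of "P ?h" \<omega>]) (simp add: P_def)
  then have \<omega>': "\<omega>' \<in> space M" "restrict (\<lambda>s. \<xi> s \<omega>') {..<t} = ?h"
    by (simp_all add: P_def)
  have "Y \<omega> = Y \<omega>'"
    using fun_cong[OF \<omega>'(2)] by (intro assms \<omega> \<omega>') (metis lessThan_iff restrict_apply')
  then show "Y \<omega> = Y (SOME \<omega>'. P ?h \<omega>')"
    by (simp add: \<omega>'_def)
qed

text \<open>With a finite sample type there are finitely many histories, so every function of the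
  history is measurable and bounded, and the iterates need no measurable structure. Independence
  comes from the disjointness of the index sets \<open>{t}\<close> and
  \<open>{..<t}\<close>.\<close>

lemma past_integrable_and_independent:
  fixes \<xi> :: "nat \<Rightarrow> 'a \<Rightarrow> 's::finite" and Y :: "'a \<Rightarrow> real"
  assumes indep: "indep_vars (\<lambda>_. count_space UNIV) \<xi> UNIV"
    and past: "\<And>\<omega> \<omega>'. \<lbrakk>\<omega> \<in> space M; \<omega>' \<in> space M; \<And>s. s < t \<Longrightarrow> \<xi> s \<omega> = \<xi> s \<omega>'\<rbrakk> \<Longrightarrow> Y \<omega> = Y \<omega>'"
  shows "integrable M Y"
    and "expectation (\<lambda>\<omega>. indicator {x} (\<xi> t \<omega>) * Y \<omega>)
      = prob {\<omega> \<in> space M. \<xi> t \<omega> = x} * expectation Y"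
    and "integrable M (\<lambda>\<omega>. indicator {x} (\<xi> t \<omega>) * Y \<omega>)"
proof -
  obtain F where F: "\<And>\<omega>. \<omega> \<in> space M \<Longrightarrow> Y \<omega> = F (restrict (\<lambda>s. \<xi> s \<omega>) {..<t})"
    using past_factors[of t \<xi> Y] past by metis
  let ?H = "\<lambda>\<omega>. restrict (\<lambda>s. \<xi> s \<omega>) {..<t}" and ?T = "\<lambda>\<omega>. restrict (\<lambda>s. \<xi> s \<omega>) {t}"
  let ?X = "\<lambda>\<omega>. indicator {x} (\<xi> t \<omega>) :: real"
  have rv [measurable]: "\<xi> s \<in> measurable M (count_space UNIV)" for s
    using indep by (simp add: indep_vars_def)
  \<comment> \<open>On a finite product of finite discrete spaces every set is measurable, so the
    arbitrary choice of \<open>F\<close> does no harm.\<close>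
  have PiM: "PiM A (\<lambda>_. count_space (UNIV :: 's set)) = count_space (PiE A (\<lambda>_. UNIV))"
    if "finite A" for A :: "nat set"
    using count_space_PiM_finite[OF that, of "\<lambda>_. UNIV :: 's set"] by (simp add: countable_finite)
  have "indep_var (PiM {t} (\<lambda>_. count_space UNIV)) ?T (PiM {..<t} (\<lambda>_. count_space UNIV)) ?H"
    by (intro indep_var_restrict[OF indep]) auto
  then have "indep_var borel ((\<lambda>h. indicator {x} (h t) :: real) \<circ> ?T) borel (F \<circ> ?H)"
    by (rule indep_var_compose) (simp_all add: PiM)
  then have ind: "indep_var borel ?X borel (F \<circ> ?H)"
    by (simp add: o_def)
  have fin: "finite (PiE {..<t} (\<lambda>_. UNIV :: 's set))"
    by (intro finite_PiE) auto
  have "?H \<in> measurable M (PiM {..<t} (\<lambda>_. count_space UNIV))"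
    by measurable
  then have FH: "F \<circ> ?H \<in> borel_measurable M"
    by (rule measurable_comp) (simp add: PiM)
  have "integrable M (F \<circ> ?H)"
  proof (rule integrable_const_bound[OF _ FH])
    show "AE \<omega> in M. norm ((F \<circ> ?H) \<omega>) \<le> Max ((\<lambda>h. norm (F h)) ` PiE {..<t} (\<lambda>_. UNIV))"
      using fin by (intro always_eventually allI Max_ge) auto
  qed
  note Y = this
  have X: "integrable M ?X"
    by (rule integrable_const_bound[of _ 1]) (auto simp: indicator_def)
  note XY = indep_var_integrable[OF ind X Y] indep_var_lebesgue_integral[OF ind X Y]
  have "expectation ?X = expectation (indicator {\<omega> \<in> space M. \<xi> t \<omega> = x})"
    by (intro Bochner_Integration.integral_cong) (auto simp: indicator_def)
  also have "\<dots> = prob {\<omega> \<in> space M. \<xi> t \<omega> = x}"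
    by simp
  finally have EX: "expectation ?X = prob {\<omega> \<in> space M. \<xi> t \<omega> = x}" .
  have "integrable M Y \<longleftrightarrow> integrable M (F \<circ> ?H)"
    by (intro Bochner_Integration.integrable_cong) (simp_all add: F)
  with Y show "integrable M Y" by simp
  have "integrable M (\<lambda>\<omega>. ?X \<omega> * Y \<omega>) \<longleftrightarrow> integrable M (\<lambda>\<omega>. ?X \<omega> * (F \<circ> ?H) \<omega>)"
    by (intro Bochner_Integration.integrable_cong) (simp_all add: F)
  with XY show "integrable M (\<lambda>\<omega>. ?X \<omega> * Y \<omega>)" by simp
  have "expectation (\<lambda>\<omega>. ?X \<omega> * Y \<omega>) = expectation (\<lambda>\<omega>. ?X \<omega> * (F \<circ> ?H) \<omega>)"
    by (intro Bochner_Integration.integral_cong) (simp_all add: F)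
  moreover have "expectation Y = expectation (F \<circ> ?H)"
    by (intro Bochner_Integration.integral_cong) (simp_all add: F)
  ultimately show "expectation (\<lambda>\<omega>. ?X \<omega> * Y \<omega>) = prob {\<omega> \<in> space M. \<xi> t \<omega> = x} * expectation Y"
    using XY EX by (simp add: o_def)
qed

text \<open>The geometry enters only through \<open>descent\<close>, \<open>lip\<close>,
  \<open>bound\<close> and the confinement to \<open>K\<close>. The linear term in
  \<open>descent\<close> may have either sign for a single sample; only its mean over
  \<open>x\<close> is |D p|^2.\<close>

theorem adaptive_sgd_gradient_tendsto_zero:
  fixes \<xi> :: "nat \<Rightarrow> 'a \<Rightarrow> 's::finite" and z :: "nat \<Rightarrow> 'a \<Rightarrow> 'p"
    and v :: "'s \<Rightarrow> 'p \<Rightarrow> 'v::real_inner" and R :: "'p \<Rightarrow> 'v \<Rightarrow> 'p"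
  assumes indep: "indep_vars (\<lambda>_. count_space UNIV) \<xi> UNIV"
    and distr: "\<And>t x. prob {\<omega> \<in> space M. \<xi> t \<omega> = x} = w x"
    and D: "\<And>p. D p = (\<Sum>x\<in>UNIV. w x *\<^sub>R v x p)"
    and pos: "0 < \<alpha>" "0 < \<beta>" "0 < \<epsilon>" "\<epsilon> \<le> 1 / 2"
    and eta: "\<And>t \<omega>. \<omega> \<in> space M \<Longrightarrow>
      \<eta> t \<omega> = \<alpha> / (\<beta> + (\<Sum>s<t. (norm (v (\<xi> s \<omega>) (z s \<omega>)))\<^sup>2)) powr (1 / 2 + \<epsilon>)"
    and init: "\<And>\<omega>. \<omega> \<in> space M \<Longrightarrow> z 0 \<omega> = z\<^sub>0"
    and step: "\<And>t \<omega>. \<omega> \<in> space M \<Longrightarrow> z (Suc t) \<omega> = R (z t \<omega>) (- \<eta> t \<omega> *\<^sub>R v (\<xi> t \<omega>) (z t \<omega>))"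
    and inK: "\<And>t \<omega>. \<omega> \<in> space M \<Longrightarrow> z t \<omega> \<in> K"
    and bound: "\<And>x p. p \<in> K \<Longrightarrow> norm (v x p) \<le> B"
    and descent: "\<And>x p h. \<lbrakk>p \<in> K; 0 < h; h \<le> \<alpha> / \<beta> powr (1 / 2 + \<epsilon>); R p (- h *\<^sub>R v x p) \<in> K\<rbrakk> \<Longrightarrow>
      f (R p (- h *\<^sub>R v x p)) \<le> f p - h * (D p \<bullet> v x p) + C * (h * norm (v x p))\<^sup>2"
    and lip: "\<And>x p h. \<lbrakk>p \<in> K; 0 < h; h \<le> \<alpha> / \<beta> powr (1 / 2 + \<epsilon>); R p (- h *\<^sub>R v x p) \<in> K\<rbrakk> \<Longrightarrow>
      \<bar>norm (D (R p (- h *\<^sub>R v x p))) - norm (D p)\<bar> \<le> L * (h * norm (v x p))"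
    and f_nonneg: "\<And>p. p \<in> K \<Longrightarrow> 0 \<le> f p" and C: "0 \<le> C"
  shows "AE \<omega> in M. (\<lambda>t. norm (D (z t \<omega>))) \<longlonglongrightarrow> 0"
proof -
  \<comment> \<open>All earlier iterates are carried along because \<open>\<eta> t\<close> depends
    on every one of them.\<close>
  have past_upto: "\<forall>s\<le>t. z s \<omega> = z s \<omega>'"
    if "\<omega> \<in> space M" "\<omega>' \<in> space M" "\<And>s. s < t \<Longrightarrow> \<xi> s \<omega> = \<xi> s \<omega>'" for t \<omega> \<omega>'
    using that(3)
  proof (induction t)
    case 0
    then show ?case using init that by simp
  next
    case (Suc t)
    then have IH: "\<forall>s\<le>t. z s \<omega> = z s \<omega>'" by simp
    then have "\<eta> t \<omega> = \<eta> t \<omega>'"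
      using Suc.prems that by (simp add: eta)
    then have "z (Suc t) \<omega> = z (Suc t) \<omega>'"
      using IH Suc.prems that by (simp add: step)
    with IH show ?case by (auto simp: le_Suc_eq)
  qed
  have past_z: "z t \<omega> = z t \<omega>'" and past_eta: "\<eta> t \<omega> = \<eta> t \<omega>'"
    if "\<omega> \<in> space M" "\<omega>' \<in> space M" "\<And>s. s < t \<Longrightarrow> \<xi> s \<omega> = \<xi> s \<omega>'" for t \<omega> \<omega>'
    using past_upto[OF that] that by (auto simp: eta)
  \<comment> \<open>Quantities that also involve the sample at time \<open>t\<close> are functions
    of the history before \<open>Suc t\<close>.\<close>
  have past_z_Suc: "z t \<omega> = z t \<omega>'" and past_eta_Suc: "\<eta> t \<omega> = \<eta> t \<omega>'"
    if "\<omega> \<in> space M" "\<omega>' \<in> space M" "\<And>s. s < Suc t \<Longrightarrow> \<xi> s \<omega> = \<xi> s \<omega>'" for t \<omega> \<omega>'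
    using past_z[OF that(1,2), of t] past_eta[OF that(1,2), of t] that(3) by auto

  define q where "q t \<omega> = norm (v (\<xi> t \<omega>) (z t \<omega>))" for t \<omega>
  define E where "E = \<alpha> / \<beta> powr (1 / 2 + \<epsilon>)"
  define S where "S t \<omega> = \<beta> + (\<Sum>s<t. (q s \<omega>)\<^sup>2)" for t \<omega>
  have S: "\<beta> \<le> S t \<omega>" for t \<omega>
    by (simp add: S_def sum_nonneg)
  then have Sp: "0 < S t \<omega>" for t \<omega>
    using pos(2) by (meson less_le_trans)
  have eta_S: "\<eta> t \<omega> = \<alpha> / S t \<omega> powr (1 / 2 + \<epsilon>)" if "\<omega> \<in> space M" for t \<omega>
    using that by (simp add: eta S_def q_def)
  have eta_pos: "0 < \<eta> t \<omega>" and eta_le: "\<eta> t \<omega> \<le> E" if "\<omega> \<in> space M" for t \<omega>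
    unfolding eta_S[OF that] E_def using pos S[of t \<omega>] Sp[of t \<omega>]
    by (auto intro!: divide_left_mono powr_mono2 mult_pos_pos)
  have q: "0 \<le> q t \<omega>" "q t \<omega> \<le> B" if "\<omega> \<in> space M" for t \<omega>
    using bound[OF inK[OF that]] by (auto simp: q_def)
  have B: "0 \<le> B"
    using q not_empty by (metis all_not_in_conv order_trans)
  \<comment> \<open>The value given by \<open>adaptive_sum_bound\<close> for d = 2 \<epsilon>:
    squaring the step turns the exponent 1/2 + \<epsilon> into 1 + 2 \<epsilon>, and \<epsilon> > 0
    makes d positive.\<close>
  define Bd where "Bd = \<alpha>\<^sup>2 * ((1 + B\<^sup>2 / \<beta>) powr (1 + 2 * \<epsilon>) * (\<beta> powr - (2 * \<epsilon>) / (2 * \<epsilon>)))"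
  have sumsq: "(\<Sum>t<T. (\<eta> t \<omega> * q t \<omega>)\<^sup>2) \<le> Bd" if \<omega>: "\<omega> \<in> space M" for T \<omega>
  proof -
    have "(\<eta> t \<omega> * q t \<omega>)\<^sup>2 = \<alpha>\<^sup>2 * ((q t \<omega>)\<^sup>2 / S t \<omega> powr (1 + 2 * \<epsilon>))" for t
    proof -
      have "(S t \<omega> powr (1 / 2 + \<epsilon>))\<^sup>2 = S t \<omega> powr (1 + 2 * \<epsilon>)"
        using Sp[of t \<omega>] by (simp add: power2_eq_square powr_add[symmetric])
      then show ?thesis
        by (simp add: eta_S[OF \<omega>] power_mult_distrib power_divide)
    qed
    then have "(\<Sum>t<T. (\<eta> t \<omega> * q t \<omega>)\<^sup>2) = \<alpha>\<^sup>2 * (\<Sum>t<T. (q t \<omega>)\<^sup>2 / S t \<omega> powr (1 + 2 * \<epsilon>))"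
      by (simp add: sum_distrib_left)
    also have "\<dots> \<le> Bd"
      unfolding Bd_def S_def
      by (intro mult_left_mono adaptive_sum_bound) (use pos q[OF \<omega>] B in \<open>auto intro: power_mono\<close>)
    finally show ?thesis .
  qed

  define b where "b t \<omega> = norm (D (z t \<omega>))" for t \<omega>
  define X where "X t \<omega> = \<eta> t \<omega> * (D (z t \<omega>) \<bullet> v (\<xi> t \<omega>) (z t \<omega>))" for t \<omega>
  define g where "g t \<omega> = \<eta> t \<omega> * (b t \<omega>)\<^sup>2" for t \<omega>
  note pii = past_integrable_and_independent[OF indep]
  have int_f: "integrable M (\<lambda>\<omega>. f (z t \<omega>))" for t
    by (rule pii(1)[of t]) (metis past_z)
  have int_g: "integrable M (g t)" for t
    unfolding g_def b_def by (rule pii(1)[of t]) (metis past_z past_eta)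
  have int_X: "integrable M (X t)" for t
    unfolding X_def by (rule pii(1)[of "Suc t"]) (metis past_z_Suc past_eta_Suc lessI)
  have int_q: "integrable M (\<lambda>\<omega>. (\<eta> t \<omega> * q t \<omega>)\<^sup>2)" for t
    unfolding q_def by (rule pii(1)[of "Suc t"]) (metis past_z_Suc past_eta_Suc lessI)
  \<comment> \<open>Splitting by the value of the sample at time \<open>t\<close> leaves factors
    \<open>Y x\<close> that depend on earlier samples only; independence then averages the sampled
    gradients to \<open>D\<close>.\<close>
  have EX: "expectation (X t) = expectation (g t)" for t
  proof -
    define Y where "Y x \<omega> = \<eta> t \<omega> * (D (z t \<omega>) \<bullet> v x (z t \<omega>))" for x \<omega>
    have past_Y: "Y x \<omega> = Y x \<omega>'"
      if "\<omega> \<in> space M" "\<omega>' \<in> space M" "\<And>s. s < t \<Longrightarrow> \<xi> s \<omega> = \<xi> s \<omega>'" for x \<omega> \<omega>'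
      unfolding Y_def using past_z[OF that] past_eta[OF that] by simp
    have "X t \<omega> = (\<Sum>x\<in>UNIV. indicator {x} (\<xi> t \<omega>) * Y x \<omega>)" for \<omega>
    proof -
      have "(\<Sum>x\<in>UNIV. indicator {x} (\<xi> t \<omega>) * Y x \<omega>) = (\<Sum>x\<in>UNIV. if x = \<xi> t \<omega> then Y x \<omega> else 0)"
        by (intro sum.cong) (auto simp: indicator_def)
      then show ?thesis by (simp add: X_def Y_def)
    qed
    then have "expectation (X t) = expectation (\<lambda>\<omega>. \<Sum>x\<in>UNIV. indicator {x} (\<xi> t \<omega>) * Y x \<omega>)"
      by presburger
    also have "\<dots> = (\<Sum>x\<in>UNIV. expectation (\<lambda>\<omega>. indicator {x} (\<xi> t \<omega>) * Y x \<omega>))"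
      by (intro Bochner_Integration.integral_sum pii(3)) (rule past_Y)
    also have "\<dots> = (\<Sum>x\<in>UNIV. w x * expectation (Y x))"
    proof (rule sum.cong[OF refl])
      fix x
      show "expectation (\<lambda>\<omega>. indicator {x} (\<xi> t \<omega>) * Y x \<omega>) = w x * expectation (Y x)"
        unfolding distr[of t x, symmetric] by (rule pii(2)) (rule past_Y)
    qed
    also have "\<dots> = expectation (\<lambda>\<omega>. \<Sum>x\<in>UNIV. w x * Y x \<omega>)"
    proof -
      have "integrable M (Y x)" for x
        by (rule pii(1)[of t]) (rule past_Y)
      then show ?thesis by simp
    qed
    also have "\<dots> = expectation (g t)"
    proof (intro Bochner_Integration.integral_cong refl)
      fix \<omega>
      have "(\<Sum>x\<in>UNIV. w x * Y x \<omega>) = \<eta> t \<omega> * (D (z t \<omega>) \<bullet> (\<Sum>x\<in>UNIV. w x *\<^sub>R v x (z t \<omega>)))"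
        by (simp add: Y_def inner_sum_right sum_distrib_left mult_ac)
      then show "(\<Sum>x\<in>UNIV. w x * Y x \<omega>) = g t \<omega>"
        by (simp add: g_def b_def D[symmetric] power2_norm_eq_inner)
    qed
    finally show ?thesis .
  qed
  have telescope: "expectation (\<lambda>\<omega>. f (z T \<omega>)) + (\<Sum>t<T. expectation (g t))
      \<le> f z\<^sub>0 + C * (\<Sum>t<T. expectation (\<lambda>\<omega>. (\<eta> t \<omega> * q t \<omega>)\<^sup>2))" for T
  proof (induction T)
    case 0
    have "expectation (\<lambda>\<omega>. f (z 0 \<omega>)) = expectation (\<lambda>\<omega>. f z\<^sub>0)"
      by (intro Bochner_Integration.integral_cong) (auto simp: init)
    then show ?case by (simp add: prob_space)
  next
    case (Suc T)
    have "expectation (\<lambda>\<omega>. f (z (Suc T) \<omega>))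
        \<le> expectation (\<lambda>\<omega>. f (z T \<omega>) - X T \<omega> + C * (\<eta> T \<omega> * q T \<omega>)\<^sup>2)"
    proof (rule integral_mono)
      fix \<omega> assume \<omega>: "\<omega> \<in> space M"
      show "f (z (Suc T) \<omega>) \<le> f (z T \<omega>) - X T \<omega> + C * (\<eta> T \<omega> * q T \<omega>)\<^sup>2"
        using descent[OF inK[OF \<omega>] eta_pos[OF \<omega>] eta_le[OF \<omega>, unfolded E_def], of T T "\<xi> T \<omega>"]
          inK[OF \<omega>, of "Suc T"]
        by (simp add: step[OF \<omega>] X_def q_def)
    qed (use int_f int_X int_q in auto)
    also have "\<dots> = expectation (\<lambda>\<omega>. f (z T \<omega>)) - expectation (g T)
        + C * expectation (\<lambda>\<omega>. (\<eta> T \<omega> * q T \<omega>)\<^sup>2)"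
      using int_f int_X int_q by (simp add: EX[symmetric])
    finally show ?case
      using Suc by (simp add: distrib_left)
  qed
  have sum_g: "(\<Sum>t<T. expectation (g t)) \<le> f z\<^sub>0 + C * Bd" for T
  proof -
    have "(\<Sum>t<T. expectation (\<lambda>\<omega>. (\<eta> t \<omega> * q t \<omega>)\<^sup>2))
        = expectation (\<lambda>\<omega>. \<Sum>t<T. (\<eta> t \<omega> * q t \<omega>)\<^sup>2)"
      using int_q by simp
    also have "\<dots> \<le> expectation (\<lambda>\<omega>. Bd)"
      using int_q sumsq by (intro integral_mono) auto
    also have "\<dots> = Bd"
      by (simp add: prob_space)
    finally have "C * (\<Sum>t<T. expectation (\<lambda>\<omega>. (\<eta> t \<omega> * q t \<omega>)\<^sup>2)) \<le> C * Bd"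
      using C by (rule mult_left_mono)
    moreover have "0 \<le> expectation (\<lambda>\<omega>. f (z T \<omega>))"
      using f_nonneg inK by (intro Bochner_Integration.integral_nonneg_AE AE_I2) auto
    ultimately show ?thesis
      using telescope[of T] by linarith
  qed
  have g_nonneg: "0 \<le> g t \<omega>" if "\<omega> \<in> space M" for t \<omega>
    using eta_pos[OF that, of t] by (simp add: g_def)
  have [measurable]: "g t \<in> borel_measurable M" for t
    using int_g by auto
  \<comment> \<open>Monotone convergence turns the uniform bound on partial sums into a finite
    integral of the whole series.\<close>
  have "(\<integral>\<^sup>+ \<omega>. (\<Sum>t. ennreal (g t \<omega>)) \<partial>M) = (\<Sum>t. \<integral>\<^sup>+ \<omega>. ennreal (g t \<omega>) \<partial>M)"
    by (intro nn_integral_suminf) measurable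
  also have "\<dots> = (\<Sum>t. ennreal (expectation (g t)))"
    using int_g g_nonneg by (intro suminf_cong nn_integral_eq_integral) (auto intro!: AE_I2)
  also have "\<dots> \<le> ennreal (f z\<^sub>0 + C * Bd)"
  proof (intro suminf_le_const summableI)
    fix T
    have "(\<Sum>t<T. ennreal (expectation (g t))) = ennreal (\<Sum>t<T. expectation (g t))"
      using g_nonneg by (intro sum_ennreal Bochner_Integration.integral_nonneg_AE AE_I2) auto
    then show "(\<Sum>t<T. ennreal (expectation (g t))) \<le> ennreal (f z\<^sub>0 + C * Bd)"
      using sum_g[of T] by (simp add: ennreal_leI)
  qed
  finally have "(\<integral>\<^sup>+ \<omega>. (\<Sum>t. ennreal (g t \<omega>)) \<partial>M) \<noteq> \<infinity>"
    by (auto simp: top_unique)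
  then have "AE \<omega> in M. (\<Sum>t. ennreal (g t \<omega>)) \<noteq> \<infinity>"
    by (intro nn_integral_PInf_AE) auto
  then show ?thesis
  proof (rule AE_mp, intro AE_I2 impI)
    fix \<omega> assume \<omega>: "\<omega> \<in> space M" and "(\<Sum>t. ennreal (g t \<omega>)) \<noteq> \<infinity>"
    then have weighted: "summable (\<lambda>t. \<eta> t \<omega> * (b t \<omega>)\<^sup>2)"
      using summable_suminf_not_top[of "\<lambda>t. g t \<omega>"] g_nonneg[OF \<omega>] by (simp add: g_def)
    have square: "summable (\<lambda>t. (\<eta> t \<omega> * q t \<omega>)\<^sup>2)"
      by (intro summableI_nonneg_bounded[where x = Bd] sumsq[OF \<omega>]) simp
    \<comment> \<open>Chosen because 1 + S t is at most (1 + \<beta> + B^2) (t + 1).\<close>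
    define c where "c = \<alpha> / (1 + \<beta> + B\<^sup>2)"
    have c: "0 < c"
      unfolding c_def using pos by (intro divide_pos_pos add_pos_nonneg) auto
    have harmonic: "c / real (Suc t) \<le> \<eta> t \<omega>" for t
    proof -
      have "(\<Sum>s<t. (q s \<omega>)\<^sup>2) \<le> (\<Sum>s<t. B\<^sup>2)"
        using q[OF \<omega>] by (intro sum_mono power_mono) auto
      then have le: "1 + S t \<omega> \<le> (1 + \<beta> + B\<^sup>2) * real (Suc t)"
      proof -
        have "(1 + \<beta> + B\<^sup>2) * real (Suc t) = 1 + \<beta> + B\<^sup>2 + real t + \<beta> * real t + real t * B\<^sup>2"
          by (simp add: algebra_simps)
        moreover have "0 \<le> \<beta> * real t"
          using pos by simp
        moreover have "(\<Sum>s<t. B\<^sup>2) = real t * B\<^sup>2"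
          by simp
        ultimately show ?thesis
          using \<open>(\<Sum>s<t. (q s \<omega>)\<^sup>2) \<le> (\<Sum>s<t. B\<^sup>2)\<close> zero_le_power2[of B]
          unfolding S_def by linarith
      qed
      \<comment> \<open>Adding 1 makes the base at least 1, so the exponent may be raised to 1; this
        uses \<epsilon> \<le> 1/2.\<close>
      have "S t \<omega> powr (1 / 2 + \<epsilon>) \<le> (1 + S t \<omega>) powr (1 / 2 + \<epsilon>)"
        using Sp[of t \<omega>] pos by (intro powr_mono2) auto
      also have "\<dots> \<le> (1 + S t \<omega>) powr 1"
        using Sp[of t \<omega>] pos by (intro powr_mono) auto
      also have "\<dots> \<le> (1 + \<beta> + B\<^sup>2) * real (Suc t)"
        using le Sp[of t \<omega>] by simp
      finally have "S t \<omega> powr (1 / 2 + \<epsilon>) \<le> (1 + \<beta> + B\<^sup>2) * real (Suc t)" .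
      moreover have "0 < S t \<omega> powr (1 / 2 + \<epsilon>)"
        using Sp[of t \<omega>] by simp
      ultimately have "\<alpha> / ((1 + \<beta> + B\<^sup>2) * real (Suc t)) \<le> \<alpha> / S t \<omega> powr (1 / 2 + \<epsilon>)"
        using pos by (intro frac_le) auto
      then show ?thesis
        unfolding eta_S[OF \<omega>] c_def divide_divide_eq_left .
    qed
    have incr: "\<bar>b (Suc t) \<omega> - b t \<omega>\<bar> \<le> L * (\<eta> t \<omega> * q t \<omega>)" for t
      using lip[OF inK[OF \<omega>] eta_pos[OF \<omega>] eta_le[OF \<omega>, unfolded E_def], of t t "\<xi> t \<omega>"]
        inK[OF \<omega>, of "Suc t"]
      by (simp add: step[OF \<omega>] b_def q_def)
    have "(\<lambda>t. b t \<omega>) \<longlonglongrightarrow> 0"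
      by (rule LIMSEQ_zero_of_weighted_square_summable[of "\<lambda>t. b t \<omega>" "\<lambda>t. \<eta> t \<omega>" E "\<lambda>t. q t \<omega>" B c L])
        (use eta_pos[OF \<omega>] eta_le[OF \<omega>] q[OF \<omega>] weighted square c harmonic incr in \<open>auto simp: b_def\<close>)
    then show "(\<lambda>t. norm (D (z t \<omega>))) \<longlonglongrightarrow> 0"
      by (simp add: b_def)
  qed
qed

end

section \<open>The low-rank objective\<close>

lemma bounded_bilinear_vec_times: "bounded_bilinear ((*) :: real ^ 'k \<Rightarrow> real ^ 'k \<Rightarrow> real ^ 'k)"
proof -
  have "bilinear ((*) :: real ^ 'k \<Rightarrow> real ^ 'k \<Rightarrow> real ^ 'k)"
    unfolding bilinear_def by (auto intro!: linearI simp: vec_eq_iff algebra_simps)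
  then show ?thesis by (simp add: bilinear_conv_bounded_bilinear)
qed

lemma bounded_linear_axis: "bounded_linear (axis i :: real ^ 'k \<Rightarrow> real ^ 'k ^ 'm)"
  unfolding linear_conv_bounded_linear[symmetric]
  by (auto intro!: linearI simp: axis_def vec_eq_iff)

text \<open>Lets the projection pass through the weighted sum, so that the gradient of G is the mean
  of the sampled gradients.\<close>

lemma linear_proj_mfd:
  "linear (proj_mfd (p :: ('m::finite, 'k::finite, 'n::finite) triple))"
  by (rule linearI)
    (simp_all add: proj_mfd_def proj_stiefel_def matrix_mult_bilinear_simps transpose_add
      transpose_scalar algebra_simps)

lemma lipschitz_on_balls_proj_stiefel:
  fixes g h :: "'a::real_normed_vector \<Rightarrow> real ^ 'k ^ 'm"
  assumes g: "lipschitz_on_balls g" and h: "lipschitz_on_balls h"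
  shows "lipschitz_on_balls (\<lambda>p. proj_stiefel (g p) (h p))"
  unfolding proj_stiefel_def
  by (intro lipschitz_on_balls_diff g h lipschitz_on_balls_add
      lipschitz_on_balls_bilinear[OF bounded_bilinear_matrix_mult]
      lipschitz_on_balls_compose_bounded_linear[OF bounded_linear_scaleR_right]
      lipschitz_on_balls_compose_bounded_linear[OF bounded_linear_transpose])

lemma lipschitz_on_balls_proj_mfd:
  fixes f :: "('m::finite, 'k::finite, 'n::finite) triple \<Rightarrow> ('m, 'k, 'n) triple"
  assumes f: "lipschitz_on_balls f"
  shows "lipschitz_on_balls (\<lambda>p. proj_mfd p (f p))"
  unfolding proj_mfd_def
  by (intro lipschitz_on_balls_Pair lipschitz_on_balls_proj_stiefel f
      lipschitz_on_balls_compose_bounded_linear[OF bounded_linear_fst]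
      lipschitz_on_balls_compose_bounded_linear[OF bounded_linear_snd]
      lipschitz_on_balls_bounded_linear[OF bounded_linear_ident])

definition entry :: "'m \<times> 'n \<Rightarrow> ('m::finite, 'k::finite, 'n::finite) triple \<Rightarrow> real" where
  "entry s p = (\<Sum>l\<in>UNIV. fst p $ fst s $ l * fst (snd p) $ l * snd (snd p) $ snd s $ l)"

definition entry_grad ::
  "'m \<times> 'n \<Rightarrow> ('m::finite, 'k::finite, 'n::finite) triple \<Rightarrow> ('m, 'k, 'n) triple" where
  "entry_grad s p =
     (axis (fst s) (fst (snd p) * snd (snd p) $ snd s), fst p $ fst s * snd (snd p) $ snd s,
      axis (snd s) (fst p $ fst s * fst (snd p)))"

lemma has_derivative_entry:
  fixes p :: "('m::finite, 'k::finite, 'n::finite) triple"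
  shows "(entry s has_derivative (\<lambda>w. entry_grad s p \<bullet> w)) (at p)"
proof -
  have U: "((\<lambda>p. fst p $ i $ l) has_derivative (\<lambda>w. fst w $ i $ l)) (at p)" for i l
    by (intro bounded_linear_imp_has_derivative bounded_linear_compose[OF bounded_linear_vec_nth
          bounded_linear_compose[OF bounded_linear_vec_nth bounded_linear_fst]])
  have V: "((\<lambda>p. snd (snd p) $ i $ l) has_derivative (\<lambda>w. snd (snd w) $ i $ l)) (at p)" for i l
    by (intro bounded_linear_imp_has_derivative bounded_linear_compose[OF bounded_linear_vec_nth
          bounded_linear_compose[OF bounded_linear_vec_nth
            bounded_linear_compose[OF bounded_linear_snd bounded_linear_snd]]])
  have x: "((\<lambda>p. fst (snd p) $ l) has_derivative (\<lambda>w. fst (snd w) $ l)) (at p)" for l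
    by (intro bounded_linear_imp_has_derivative bounded_linear_compose[OF bounded_linear_vec_nth
          bounded_linear_compose[OF bounded_linear_fst bounded_linear_snd]])
  have "(entry s has_derivative (\<lambda>w. \<Sum>l\<in>UNIV.
      fst p $ fst s $ l * fst (snd p) $ l * snd (snd w) $ snd s $ l
      + (fst p $ fst s $ l * fst (snd w) $ l + fst w $ fst s $ l * fst (snd p) $ l)
        * snd (snd p) $ snd s $ l)) (at p)"
    unfolding entry_def[abs_def] by (intro has_derivative_sum has_derivative_mult U x V)
  moreover have "(\<Sum>l\<in>UNIV.
      fst p $ fst s $ l * fst (snd p) $ l * snd (snd w) $ snd s $ l
      + (fst p $ fst s $ l * fst (snd w) $ l + fst w $ fst s $ l * fst (snd p) $ l)
        * snd (snd p) $ snd s $ l) = entry_grad s p \<bullet> w" for w :: "('m, 'k, 'n) triple"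
    by (cases w) (simp add: entry_grad_def inner_axis', simp add: inner_vec_def sum.distrib algebra_simps)
  ultimately show ?thesis by simp
qed

text \<open>\<open>sample_g\<close> with |x|^2 in place of the squared norm of U D(x) V^T. This
  extension is guaranteed to agree only on the manifold, but its regulariser contributes just 2 lam
  x to the gradient, the form needed to control |x|.\<close>

definition ext_g ::
  "real ^ 'n ^ 'm \<Rightarrow> real \<Rightarrow> 'm \<times> 'n \<Rightarrow> ('m::finite, 'k::finite, 'n::finite) triple \<Rightarrow> real" where
  "ext_g A lam s p =
     (A $ fst s $ snd s - entry s p)\<^sup>2 + lam * (fst (snd p) \<bullet> fst (snd p))"

definition ext_grad ::
  "real ^ 'n ^ 'm \<Rightarrow> real \<Rightarrow> 'm \<times> 'n \<Rightarrow> ('m::finite, 'k::finite, 'n::finite) triple \<Rightarrow>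
   ('m, 'k, 'n) triple" where
  "ext_grad A lam s p =
     (- 2 * (A $ fst s $ snd s - entry s p)) *\<^sub>R entry_grad s p + (0, (2 * lam) *\<^sub>R fst (snd p), 0)"

lemma has_derivative_ext_g:
  fixes p :: "('m::finite, 'k::finite, 'n::finite) triple"
  shows "(ext_g A lam s has_derivative (\<lambda>w. ext_grad A lam s p \<bullet> w)) (at p)"
proof -
  have x: "((\<lambda>p. fst (snd p)) has_derivative (\<lambda>w. fst (snd w))) (at p)"
    by (intro bounded_linear_imp_has_derivative bounded_linear_compose[OF bounded_linear_fst bounded_linear_snd])
  have "(ext_g A lam s has_derivative (\<lambda>w.
      (A $ fst s $ snd s - entry s p) * (0 - entry_grad s p \<bullet> w)
      + (0 - entry_grad s p \<bullet> w) * (A $ fst s $ snd s - entry s p)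
      + lam * (fst (snd p) \<bullet> fst (snd w) + fst (snd w) \<bullet> fst (snd p)))) (at p)"
    unfolding ext_g_def[abs_def] power2_eq_square
    by (intro has_derivative_add has_derivative_mult has_derivative_diff has_derivative_const
        has_derivative_inner has_derivative_entry x has_derivative_mult_right)
  moreover have "(A $ fst s $ snd s - entry s p) * (0 - entry_grad s p \<bullet> w)
      + (0 - entry_grad s p \<bullet> w) * (A $ fst s $ snd s - entry s p)
      + lam * (fst (snd p) \<bullet> fst (snd w) + fst (snd w) \<bullet> fst (snd p)) = ext_grad A lam s p \<bullet> w"
    for w :: "('m, 'k, 'n) triple"
    by (cases w) (simp add: ext_grad_def inner_add_left inner_commute algebra_simps)
  ultimately show ?thesis by simp
qed

lemma lipschitz_on_balls_ext_grad:
  "lipschitz_on_balls (ext_grad A lam s :: ('m::finite, 'k::finite, 'n::finite) triple \<Rightarrow> _)"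
proof -
  note id = lipschitz_on_balls_bounded_linear[OF bounded_linear_ident]
  note comp = lipschitz_on_balls_compose_bounded_linear
  have U: "lipschitz_on_balls (\<lambda>p :: ('m, 'k, 'n) triple. fst p $ i)" for i
    by (intro comp[OF bounded_linear_vec_nth] comp[OF bounded_linear_fst] id)
  have x: "lipschitz_on_balls (\<lambda>p :: ('m, 'k, 'n) triple. fst (snd p))"
    by (intro comp[OF bounded_linear_fst] comp[OF bounded_linear_snd] id)
  have V: "lipschitz_on_balls (\<lambda>p :: ('m, 'k, 'n) triple. snd (snd p) $ j)" for j
    by (intro comp[OF bounded_linear_vec_nth] comp[OF bounded_linear_snd] id)
  note times = lipschitz_on_balls_bilinear[OF bounded_bilinear_vec_times]
  have entry_eq: "entry s = (\<lambda>p :: ('m, 'k, 'n) triple. (fst p $ fst s * fst (snd p)) \<bullet> snd (snd p) $ snd s)"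
    by (simp add: entry_def fun_eq_iff inner_vec_def)
  have "lipschitz_on_balls (entry s :: ('m, 'k, 'n) triple \<Rightarrow> real)"
    unfolding entry_eq by (intro lipschitz_on_balls_bilinear[OF bounded_bilinear_inner] times U x V)
  moreover have "lipschitz_on_balls (entry_grad s :: ('m, 'k, 'n) triple \<Rightarrow> _)"
    unfolding entry_grad_def[abs_def]
    by (intro lipschitz_on_balls_Pair comp[OF bounded_linear_axis] times U x V)
  ultimately show ?thesis
    unfolding ext_grad_def[abs_def]
    by (intro lipschitz_on_balls_add lipschitz_on_balls_bilinear[OF bounded_bilinear_scaleR]
        lipschitz_on_balls_Pair comp[OF bounded_linear_scaleR_right]
        comp[OF bounded_linear_mult_right] lipschitz_on_balls_diff lipschitz_on_balls_const x)
qed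

section \<open>The objectives on the manifold\<close>

lemma svd_prod_entry:
  "svd_prod p $ i $ j = entry (i, j) (p :: ('m::finite, 'k::finite, 'n::finite) triple)"
proof -
  obtain U x V where p: "p = (U, x, V)" by (cases p)
  have "(U ** diag_mat x) $ i $ l = U $ i $ l * x $ l" for l
    by (simp add: matrix_matrix_mult_def diag_mat_def if_distrib cong: if_cong)
  then show ?thesis
    by (simp add: p entry_def matrix_matrix_mult_def[of "U ** diag_mat x"] transpose_def)
qed

lemma norm_transpose: "norm (transpose A) = norm (A :: real ^ 'k ^ 'm)"
  by (simp add: norm_eq_sqrt_inner inner_transpose)

lemma norm_diag_mat: "norm (diag_mat x) = norm x"
  by (simp add: norm_eq_sqrt_inner inner_vec_def diag_mat_def if_distrib cong: if_cong)

text \<open>Two isometries, one for each Stiefel factor; transposing brings \<open>V\<close> to the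
  left.\<close>

lemma norm_svd_prod:
  fixes p :: "('m::finite, 'k::finite, 'n::finite) triple"
  assumes "p \<in> param_mfd"
  shows "norm (svd_prod p) = norm (fst (snd p))"
proof -
  obtain U x V where p: "p = (U, x, V)" by (cases p)
  have UV: "U \<in> stiefel" "V \<in> stiefel"
    using assms by (auto simp: p param_mfd_def)
  have "norm (svd_prod p) = norm (U ** (diag_mat x ** transpose V))"
    by (simp add: p matrix_mul_assoc)
  also have "\<dots> = norm (transpose (diag_mat x ** transpose V))"
    by (simp add: norm_stiefel_mult[OF UV(1)] norm_transpose)
  also have "\<dots> = norm (V ** transpose (diag_mat x))"
    by (simp add: matrix_transpose_mul)
  also have "\<dots> = norm x"
    by (simp add: norm_stiefel_mult[OF UV(2)] norm_transpose norm_diag_mat)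
  finally show ?thesis by (simp add: p)
qed

lemma sample_g_eq_ext_g:
  assumes "p \<in> param_mfd"
  shows "sample_g A lam s p = ext_g A lam s p"
  using norm_svd_prod[OF assms]
  by (cases s) (simp add: ext_g_def svd_prod_entry power2_norm_eq_inner[symmetric])

text \<open>Total weight 1 distributes the regulariser over the samples.\<close>

lemma obj_G_eq_ext_g:
  assumes p: "p \<in> param_mfd" and W: "(\<Sum>i\<in>UNIV. \<Sum>j\<in>UNIV. W $ i $ j) = 1"
  shows "obj_G A W lam p = (\<Sum>s\<in>UNIV. W $ fst s $ snd s * ext_g A lam s p)"
proof -
  have "(\<Sum>i\<in>UNIV. \<Sum>j\<in>UNIV. W $ i $ j * (lam * (norm (svd_prod p))\<^sup>2)) = lam * (norm (svd_prod p))\<^sup>2"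
    using W by (simp add: sum_distrib_right[symmetric])
  then show ?thesis
    using norm_svd_prod[OF p]
    by (simp add: obj_G_def obj_F_def sum.cartesian_product ext_g_def svd_prod_entry distrib_left
        sum.distrib power2_norm_eq_inner[symmetric] case_prod_unfold)
qed

lemma stiefel_entry_le_1:
  assumes "U \<in> stiefel"
  shows "\<bar>U $ i $ l\<bar> \<le> 1"
proof -
  have "norm (column l U) = 1"
    using assms by (simp add: stiefel_iff_orthonormal_columns norm_eq_1)
  then show ?thesis
    using component_le_norm_cart[of "column l U" i] by (simp add: column_component)
qed

lemma compact_stiefel: "compact (stiefel :: (real ^ 'k ^ 'm) set)"
proof -
  have "closed (stiefel :: (real ^ 'k ^ 'm) set)"
    unfolding stiefel_def
    by (intro closed_Collect_eq continuous_on_const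
        bounded_bilinear.continuous_on[OF bounded_bilinear_matrix_mult]
        bounded_linear.continuous_on[OF bounded_linear_transpose] continuous_on_id)
  moreover have "norm V \<le> sqrt (real CARD('k))" if "V \<in> stiefel" for V :: "real ^ 'k ^ 'm"
  proof (rule real_le_rsqrt)
    have "norm (column l V) = 1" for l
      using that by (simp add: stiefel_iff_orthonormal_columns norm_eq_1)
    then show "(norm V)\<^sup>2 \<le> real CARD('k)"
      by (simp add: norm_square_columns)
  qed
  ultimately show ?thesis
    by (auto simp: compact_eq_bounded_closed bounded_iff)
qed

text \<open>
  One step for the squared norm \<open>X\<close> of \<open>x\<close>: it decreases above \<open>\<rho>\<^sub>0\<close>, and below \<open>\<rho>\<^sub>0\<close> it cannot
  overshoot the second term of \<open>\<rho>\<^sub>1\<close>.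
\<close>

lemma square_norm_step:
  fixes x u :: "'a::real_inner" and a al lam k \<kappa> h \<rho>\<^sub>0 :: real
  assumes k: "0 \<le> k" and lam: "0 < lam" and al: "al\<^sup>2 \<le> a"
    and u: "(norm u)\<^sup>2 \<le> k" and e: "(u \<bullet> x)\<^sup>2 \<le> (norm x)\<^sup>2"
    and h: "0 \<le> h" "h \<le> \<kappa>"
    and den: "0 < 4 * lam - 16 * k * \<kappa> - 8 * lam\<^sup>2 * \<kappa>"
    and \<rho>\<^sub>0: "\<rho>\<^sub>0 = (1 + 16 * k * \<kappa>) * a / (4 * lam - 16 * k * \<kappa> - 8 * lam\<^sup>2 * \<kappa>)"
    and \<rho>\<^sub>1: "\<rho>\<^sub>0 + a * \<kappa> + (16 * k * a + 8 * lam\<^sup>2 * \<rho>\<^sub>0 + 16 * k * \<rho>\<^sub>0) * \<kappa>\<^sup>2 \<le> \<rho>\<^sub>1"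
    and x: "(norm x)\<^sup>2 \<le> \<rho>\<^sub>1"
  defines "g \<equiv> (- 2 * (al - u \<bullet> x)) *\<^sub>R u + (2 * lam) *\<^sub>R x"
  shows "(norm (x - h *\<^sub>R g))\<^sup>2 \<le> \<rho>\<^sub>1"
proof -
  define X where "X = (norm x)\<^sup>2"
  define e where "e = u \<bullet> x"
  define N where "N = 16 * k * a + (8 * lam\<^sup>2 + 16 * k) * X"
  have X: "0 \<le> X" by (simp add: X_def)
  have a: "0 \<le> a" using al by (rule order_trans[OF zero_le_power2])
  have e2: "e\<^sup>2 \<le> X" using e by (simp add: e_def X_def)
  have N: "0 \<le> N" using k a X by (simp add: N_def)
  have xg: "x \<bullet> g = 2 * lam * X - 2 * (al - e) * e"
    by (simp add: g_def inner_add_right X_def power2_norm_eq_inner e_def inner_commute algebra_simps)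
  \<comment> \<open>Completing the square in \<open>e\<close> gives a maximum that does not depend
    on \<open>x\<close>.\<close>
  have "2 * (al - e) * e = al\<^sup>2 / 2 - 2 * (e - al / 2)\<^sup>2"
    by (simp add: power2_eq_square field_simps)
  moreover have "0 \<le> 2 * (e - al / 2)\<^sup>2" by simp
  ultimately have "2 * (al - e) * e \<le> a / 2"
    using al by linarith
  with xg have xg': "2 * lam * X - a / 2 \<le> x \<bullet> g" by linarith
  have gg: "(norm g)\<^sup>2 \<le> N"
  proof -
    have par: "(norm (v + w))\<^sup>2 \<le> 2 * (norm v)\<^sup>2 + 2 * (norm w)\<^sup>2" for v w :: 'a
    proof -
      have "(norm (v + w))\<^sup>2 + (norm (v - w))\<^sup>2 = 2 * (norm v)\<^sup>2 + 2 * (norm w)\<^sup>2"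
        by (simp add: power2_norm_eq_inner algebra_simps inner_add_left inner_add_right
            inner_diff_left inner_diff_right)
      then show ?thesis using zero_le_power2[of "norm (v - w)"] by linarith
    qed
    have "(al - e)\<^sup>2 + (al + e)\<^sup>2 = 2 * al\<^sup>2 + 2 * e\<^sup>2"
      by (simp add: power2_eq_square algebra_simps)
    then have ae: "(al - e)\<^sup>2 \<le> 2 * a + 2 * X"
      using al e2 zero_le_power2[of "al + e"] by linarith
    have "(norm g)\<^sup>2 \<le> 2 * (norm ((- 2 * (al - e)) *\<^sub>R u))\<^sup>2 + 2 * (norm ((2 * lam) *\<^sub>R x))\<^sup>2"
      unfolding g_def e_def by (rule par)
    also have "\<dots> = 8 * ((al - e)\<^sup>2 * (norm u)\<^sup>2) + 8 * lam\<^sup>2 * X"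
      unfolding norm_scaleR power_mult_distrib power2_abs X_def by simp
    also have "\<dots> \<le> 8 * ((2 * a + 2 * X) * k) + 8 * lam\<^sup>2 * X"
      using ae u a X by (intro add_right_mono mult_left_mono mult_mono) auto
    also have "\<dots> = N"
      by (simp add: N_def algebra_simps)
    finally show ?thesis .
  qed
  have "(norm (x - h *\<^sub>R g))\<^sup>2 = X - 2 * (h * (x \<bullet> g)) + h\<^sup>2 * (norm g)\<^sup>2"
    unfolding X_def power2_norm_eq_inner
    by (simp add: inner_diff_left inner_diff_right inner_commute power2_eq_square algebra_simps)
  also have "\<dots> \<le> X - 2 * (h * (2 * lam * X - a / 2)) + h\<^sup>2 * N"
    using h xg' gg by (intro add_mono diff_left_mono mult_left_mono) auto
  also have "\<dots> = X + h * (a - 4 * lam * X) + h\<^sup>2 * N"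
    by (simp add: algebra_simps)
  finally have step: "(norm (x - h *\<^sub>R g))\<^sup>2 \<le> X + h * (a - 4 * lam * X) + h\<^sup>2 * N" .
  show ?thesis
  proof (cases "\<rho>\<^sub>0 \<le> X")
    case True
    have "h\<^sup>2 * N \<le> h * (\<kappa> * N)"
      unfolding power2_eq_square mult.assoc using h N by (intro mult_left_mono mult_right_mono)
    with step have "(norm (x - h *\<^sub>R g))\<^sup>2 \<le> X + h * (a - 4 * lam * X + \<kappa> * N)"
      by (simp add: distrib_left)
    \<comment> \<open>\<open>\<rho>\<^sub>0\<close> is exactly the zero, as a function of
      \<open>X\<close>, of the bracket multiplying \<open>h\<close>, which decreases in
      \<open>X\<close> by \<open>den\<close>.\<close>
    moreover have "(1 + 16 * k * \<kappa>) * a \<le> X * (4 * lam - 16 * k * \<kappa> - 8 * lam\<^sup>2 * \<kappa>)"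
      using True den unfolding \<rho>\<^sub>0 by (simp add: pos_divide_le_eq)
    then have "a - 4 * lam * X + \<kappa> * N \<le> 0"
      by (simp add: N_def algebra_simps)
    then have "h * (a - 4 * lam * X + \<kappa> * N) \<le> 0"
      using h by (simp add: mult_nonneg_nonpos)
    ultimately show ?thesis
      using x by (simp add: X_def)
  next
    case False
    \<comment> \<open>\<open>N\<close> does not decrease with \<open>X\<close>; inserting
      \<open>\<rho>\<^sub>0\<close> for \<open>X\<close> in all positive terms and
      \<open>\<kappa>\<close> for \<open>h\<close> gives the second term of
      \<open>\<rho>\<^sub>1\<close>.\<close>
    have "N \<le> 16 * k * a + (8 * lam\<^sup>2 + 16 * k) * \<rho>\<^sub>0"
      unfolding N_def using False k by (intro add_left_mono mult_left_mono) auto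
    then have "h\<^sup>2 * N \<le> \<kappa>\<^sup>2 * (16 * k * a + (8 * lam\<^sup>2 + 16 * k) * \<rho>\<^sub>0)"
      using h N by (intro mult_mono power_mono) auto
    moreover have "h * (a - 4 * lam * X) \<le> \<kappa> * a"
    proof -
      have "h * (a - 4 * lam * X) \<le> h * a"
        using h lam X by (intro mult_left_mono) auto
      also have "\<dots> \<le> \<kappa> * a"
        using h a by (intro mult_right_mono) auto
      finally show ?thesis .
    qed
    moreover have "\<kappa>\<^sup>2 * (16 * k * a + (8 * lam\<^sup>2 + 16 * k) * \<rho>\<^sub>0)
        = (16 * k * a + 8 * lam\<^sup>2 * \<rho>\<^sub>0 + 16 * k * \<rho>\<^sub>0) * \<kappa>\<^sup>2"
      by (simp add: algebra_simps)
    ultimately show ?thesis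
      using step False \<rho>\<^sub>1 by (simp add: mult.commute[of \<kappa> a])
  qed
qed

lemma mfd_tangent_scaleR: "w \<in> mfd_tangent p \<Longrightarrow> c *\<^sub>R w \<in> mfd_tangent p"
  by (auto simp: mfd_tangent_def stiefel_tangent_def mem_Times_iff matrix_mult_bilinear_simps
      transpose_scalar scaleR_add_right[symmetric])

text \<open>The first part holds for every outcome. In the last one the null set depends neither on
  the limit point nor on the subsequence, since the quantifiers stand under
  \<open>AE\<close>.\<close>

theorem proposition3p21:
  fixes A W :: "real ^ 'n ^ 'm"
    and a lam \<kappa> \<rho>\<^sub>0 \<rho>\<^sub>1 \<alpha> \<epsilon> \<beta> k :: real
    and z\<^sub>0 :: "('m::finite, 'k::{finite,linorder}, 'n::finite) triple"
    and M :: "'w measure"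
    and \<xi> :: "nat \<Rightarrow> 'w \<Rightarrow> 'm \<times> 'n"
    and \<eta> :: "nat \<Rightarrow> 'w \<Rightarrow> real"
    and z :: "nat \<Rightarrow> 'w \<Rightarrow> ('m, 'k, 'n) triple"
    and K\<^sub>1 :: "('m, 'k, 'n) triple set"
  assumes dims: "CARD('k) \<le> min CARD('m) CARD('n)"
    and k: "k = real CARD('k)"
    and lam_pos: "lam > 0"
    and W_nonneg: "\<And>i j. W $ i $ j \<ge> 0"
    and W_sum: "(\<Sum>i\<in>UNIV. \<Sum>j\<in>UNIV. W $ i $ j) = 1"
    and a: "a = Max (range (\<lambda>(i, j). (A $ i $ j)\<^sup>2))"
    and kappa: "0 < \<kappa>" "\<kappa> < lam / (4 * k + 2 * lam\<^sup>2)"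
    and rho0: "\<rho>\<^sub>0 = (1 + 16 * k * \<kappa>) * a / (4 * lam - 16 * k * \<kappa> - 8 * lam\<^sup>2 * \<kappa>)"
    and rho0_pos: "\<rho>\<^sub>0 > 0"
    and alpha: "\<alpha> > 0"
    and eps: "0 < \<epsilon>" "\<epsilon> \<le> 1 / 2"
    and beta: "\<beta> = (\<alpha> / \<kappa>) powr (2 / (1 + 2 * \<epsilon>))"
    and z0: "z\<^sub>0 \<in> param_mfd"
    and rho1: "\<rho>\<^sub>1 = max ((norm (fst (snd z\<^sub>0)))\<^sup>2)
                 (\<rho>\<^sub>0 + a * \<kappa> + (16 * k * a + 8 * lam\<^sup>2 * \<rho>\<^sub>0 + 16 * k * \<rho>\<^sub>0) * \<kappa>\<^sup>2)"
    and prob: "prob_space M"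
    and indep: "prob_space.indep_vars M (\<lambda>_. count_space UNIV) \<xi> UNIV"
    and distr: "\<And>t i j. measure M {\<omega> \<in> space M. \<xi> t \<omega> = (i, j)} = W $ i $ j"
    and eta: "\<And>t \<omega>. \<omega> \<in> space M \<Longrightarrow>
      \<eta> t \<omega> = \<alpha> / (\<beta> + (\<Sum>s<t. (norm (riemannian_gradient param_mfd
                      (sample_g A lam (\<xi> s \<omega>)) (z s \<omega>)))\<^sup>2)) powr (1 / 2 + \<epsilon>)"
    and init: "\<And>\<omega>. \<omega> \<in> space M \<Longrightarrow> z 0 \<omega> = z\<^sub>0"
    and step: "\<And>t \<omega>. \<omega> \<in> space M \<Longrightarrow>
      z (Suc t) \<omega> = retract (z t \<omega>)
        (- \<eta> t \<omega> *\<^sub>R riemannian_gradient param_mfd (sample_g A lam (\<xi> t \<omega>)) (z t \<omega>))"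
    and K1: "K\<^sub>1 = stiefel \<times> {x. (norm x)\<^sup>2 \<le> \<rho>\<^sub>1} \<times> stiefel"
  shows "(compact K\<^sub>1 \<and> K\<^sub>1 \<subseteq> param_mfd \<and>
          (\<forall>\<omega>\<in>space M. (\<forall>t. z t \<omega> \<in> K\<^sub>1) \<and>
             (\<exists>r l. strict_mono r \<and> l \<in> param_mfd \<and> (\<lambda>i. z (r i) \<omega>) \<longlonglongrightarrow> l))) \<and>
         (AE \<omega> in M. (\<lambda>t. norm (riemannian_gradient param_mfd (obj_G A W lam) (z t \<omega>))) \<longlonglongrightarrow> 0) \<and>
         (AE \<omega> in M. \<forall>l. (\<exists>r. strict_mono r \<and> (\<lambda>i. z (r i) \<omega>) \<longlonglongrightarrow> l) \<longrightarrow>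
             stationary_point param_mfd (obj_G A W lam) l)"
proof -
  interpret prob_space M by (rule prob)
  define E where "E = \<alpha> / \<beta> powr (1 / 2 + \<epsilon>)"
  define v where "v s p = proj_mfd p (ext_grad A lam s p)"
    for s :: "'m \<times> 'n" and p :: "('m, 'k, 'n) triple"
  define f where "f p = (\<Sum>s\<in>UNIV. W $ fst s $ snd s * ext_g A lam s p)" for p :: "('m, 'k, 'n) triple"
  define F where "F p = (\<Sum>s\<in>UNIV. W $ fst s $ snd s *\<^sub>R ext_grad A lam s p)"
    for p :: "('m, 'k, 'n) triple"
  define D where "D p = (\<Sum>s\<in>UNIV. W $ fst s $ snd s *\<^sub>R v s p)" for p :: "('m, 'k, 'n) triple"
  have D_proj: "D p = proj_mfd p (F p)" for p
    unfolding D_def v_def F_def linear_sum[OF linear_proj_mfd] linear_scale[OF linear_proj_mfd] ..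
  have f_deriv: "(f has_derivative (\<lambda>w. F p \<bullet> w)) (at p)" for p
  proof -
    have "(f has_derivative (\<lambda>w. \<Sum>s\<in>UNIV. W $ fst s $ snd s * (ext_grad A lam s p \<bullet> w))) (at p)"
      unfolding f_def by (intro has_derivative_sum has_derivative_mult_right has_derivative_ext_g)
    then show ?thesis
      by (simp add: F_def inner_sum_left)
  qed
  have F_lip: "lipschitz_on_balls F"
    unfolding F_def
    by (intro lipschitz_on_balls_sum lipschitz_on_balls_ext_grad
        lipschitz_on_balls_compose_bounded_linear[OF bounded_linear_scaleR_right])
  have D_lip: "lipschitz_on_balls D"
    unfolding D_proj[abs_def] by (intro lipschitz_on_balls_proj_mfd F_lip)
  have grad_g: "riemannian_gradient param_mfd (sample_g A lam s) p = v s p" if "p \<in> param_mfd" for s p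
    unfolding v_def
    by (rule riemannian_gradient_param_mfd[OF that has_derivative_ext_g sample_g_eq_ext_g])
  have grad_G: "riemannian_gradient param_mfd (obj_G A W lam) p = D p" if "p \<in> param_mfd" for p
    unfolding D_proj
    by (rule riemannian_gradient_param_mfd[OF that f_deriv]) (simp add: obj_G_eq_ext_g W_sum f_def)

  have K_sub: "K\<^sub>1 \<subseteq> param_mfd"
    by (auto simp: K1 param_mfd_def)
  have A_le: "(A $ i $ j)\<^sup>2 \<le> a" for i j
    unfolding a by (rule Max_ge) (auto intro: rev_image_eqI)
  have K_compact: "compact K\<^sub>1"
  proof -
    have "{x :: real ^ ('k::{finite,linorder}). (norm x)\<^sup>2 \<le> \<rho>\<^sub>1} = cball 0 (sqrt \<rho>\<^sub>1)"
      by (auto intro: real_le_rsqrt sqrt_ge_absD[OF order_trans[OF abs_norm_cancel[THEN eq_refl]]])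
    then show ?thesis
      unfolding K1 by (intro compact_Times compact_stiefel) simp
  qed
  \<comment> \<open>The exponent in \<open>\<beta>\<close> is the reciprocal of 1/2 + \<epsilon>, so
    the step with an empty gradient sum, the largest one, is \<open>\<kappa>\<close>.\<close>
  have E_eq: "E = \<kappa>"
  proof -
    have "2 / (1 + 2 * \<epsilon>) * (1 / 2 + \<epsilon>) = 1"
      using eps by (simp add: field_simps)
    then have "\<beta> powr (1 / 2 + \<epsilon>) = \<alpha> / \<kappa>"
      using alpha kappa by (simp add: beta powr_powr)
    then show ?thesis
      using alpha kappa by (simp add: E_def)
  qed
  have beta_pos: "0 < \<beta>"
    using alpha kappa by (simp add: beta)
  have eta_bounds: "0 < \<eta> t \<omega>" "\<eta> t \<omega> \<le> \<kappa>" if "\<omega> \<in> space M" for t \<omega>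
  proof -
    define S where "S = \<beta> + (\<Sum>s<t. (norm (riemannian_gradient param_mfd
                      (sample_g A lam (\<xi> s \<omega>)) (z s \<omega>)))\<^sup>2)"
    have S: "\<beta> \<le> S" by (simp add: S_def sum_nonneg)
    have "\<alpha> / S powr (1 / 2 + \<epsilon>) \<le> \<alpha> / \<beta> powr (1 / 2 + \<epsilon>)"
      using S beta_pos alpha eps by (intro divide_left_mono powr_mono2 mult_pos_pos) auto
    moreover have "0 < \<alpha> / S powr (1 / 2 + \<epsilon>)"
      using S beta_pos alpha by simp
    moreover have "\<eta> t \<omega> = \<alpha> / S powr (1 / 2 + \<epsilon>)"
      unfolding S_def by (rule eta[OF that])
    ultimately show "0 < \<eta> t \<omega>" "\<eta> t \<omega> \<le> \<kappa>"
      using E_eq by (simp_all add: E_def)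
  qed
  have v_tangent: "v s p \<in> mfd_tangent p" if "p \<in> param_mfd" for s p
    unfolding v_def by (rule proj_mfd_tangent[OF that])

  have k1: "1 \<le> k"
    using zero_less_card_finite[where 'a = 'k] by (simp add: k)
  \<comment> \<open>The expression is 4 (lam - \<kappa> (4 k + 2 lam^2)), so the upper bound on
    \<kappa> is precisely its positivity.\<close>
  have den: "0 < 4 * lam - 16 * k * \<kappa> - 8 * lam\<^sup>2 * \<kappa>"
  proof -
    have "0 < 4 * k + 2 * lam\<^sup>2"
      using k1 by (intro add_pos_nonneg) auto
    then have "\<kappa> * (4 * k + 2 * lam\<^sup>2) < lam"
      using kappa(2) by (simp add: pos_less_divide_eq)
    then show ?thesis by (simp add: algebra_simps)
  qed
  have norm_step: "(norm (fst (snd (retract p (- h *\<^sub>R v s p)))))\<^sup>2 \<le> \<rho>\<^sub>1"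
    if p: "p \<in> K\<^sub>1" and h: "0 < h" "h \<le> \<kappa>" for p s h
  proof -
    obtain U x V where p_eq: "p = (U, x, V)" by (cases p)
    have UV: "U \<in> stiefel" "V \<in> stiefel" and x: "(norm x)\<^sup>2 \<le> \<rho>\<^sub>1"
      using p by (auto simp: p_eq K1)
    \<comment> \<open>For fixed \<open>U\<close> and \<open>V\<close> the entry is linear in
      \<open>x\<close>, with this coefficient vector.\<close>
    define u where "u = U $ fst s * V $ snd s"
    have entry_u: "entry s p = u \<bullet> x"
      by (simp add: entry_def p_eq u_def inner_vec_def mult_ac)
    have u: "(norm u)\<^sup>2 \<le> k"
    proof -
      have "(norm u)\<^sup>2 = (\<Sum>l\<in>UNIV. (U $ fst s $ l * V $ snd s $ l)\<^sup>2)"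
        unfolding power2_norm_eq_inner inner_vec_def by (simp add: u_def power2_eq_square)
      also have "\<dots> \<le> (\<Sum>l\<in>(UNIV :: 'k set). 1)"
      proof (rule sum_mono)
        fix l
        have "\<bar>U $ fst s $ l\<bar> * \<bar>V $ snd s $ l\<bar> \<le> 1 * 1"
          using UV by (intro mult_mono stiefel_entry_le_1) auto
        then show "(U $ fst s $ l * V $ snd s $ l)\<^sup>2 \<le> 1"
          by (simp add: abs_square_le_1 abs_mult)
      qed
      finally show ?thesis by (simp add: k)
    qed
    \<comment> \<open>Cauchy-Schwarz with |u|^2 \<le> k would lose a factor k; instead an entry is
      at most the Frobenius norm, which is |x|.\<close>
    have e: "(u \<bullet> x)\<^sup>2 \<le> (norm x)\<^sup>2"
    proof -
      have "\<bar>svd_prod p $ fst s $ snd s\<bar> \<le> norm (svd_prod p $ fst s)"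
        by (rule component_le_norm_cart)
      also have "\<dots> \<le> norm (svd_prod p)"
        by (rule Finite_Cartesian_Product.norm_nth_le)
      also have "\<dots> = norm x"
        using norm_svd_prod[of p] p K_sub by (auto simp: p_eq)
      finally have "\<bar>u \<bullet> x\<bar> \<le> \<bar>norm x\<bar>"
        by (simp add: svd_prod_entry entry_u)
      then show ?thesis by (simp only: abs_le_square_iff)
    qed
    have "fst (snd (v s p)) = (- 2 * (A $ fst s $ snd s - u \<bullet> x)) *\<^sub>R u + (2 * lam) *\<^sub>R x"
      unfolding v_def proj_mfd_def ext_grad_def entry_u by (simp add: entry_grad_def p_eq u_def)
    then have "fst (snd (retract p (- h *\<^sub>R v s p)))
        = x - h *\<^sub>R ((- 2 * (A $ fst s $ snd s - u \<bullet> x)) *\<^sub>R u + (2 * lam) *\<^sub>R x)"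
      by (cases "v s p") (simp add: p_eq)
    moreover have "(norm (x - h *\<^sub>R ((- 2 * (A $ fst s $ snd s - u \<bullet> x)) *\<^sub>R u + (2 * lam) *\<^sub>R x)))\<^sup>2 \<le> \<rho>\<^sub>1"
      by (rule square_norm_step[OF _ lam_pos A_le u e _ h(2) den rho0 _ x])
        (use k1 h(1) rho1 in auto)
    ultimately show ?thesis by simp
  qed
  have step_K: "retract p (- h *\<^sub>R v s p) \<in> K\<^sub>1"
    if p: "p \<in> K\<^sub>1" and h: "0 < h" "h \<le> \<kappa>" for p s h
  proof -
    have "retract p (- h *\<^sub>R v s p) \<in> param_mfd"
      using p K_sub by (intro retract_param_mfd mfd_tangent_scaleR v_tangent) auto
    with norm_step[OF that, of s] show ?thesis
      by (auto simp: K1 param_mfd_def)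
  qed
  \<comment> \<open>\<open>eta_bounds\<close> was obtained without knowing where the iterates are,
    so this induction is not circular.\<close>
  have inK: "z t \<omega> \<in> K\<^sub>1" if \<omega>: "\<omega> \<in> space M" for t \<omega>
  proof (induction t)
    case 0
    show ?case
      using z0 by (auto simp: init[OF \<omega>] K1 rho1 param_mfd_def)
  next
    case (Suc t)
    then show ?case
      using step_K eta_bounds[OF \<omega>] K_sub by (simp add: step[OF \<omega>] grad_g subsetD)
  qed
  have subseq: "\<exists>r l. strict_mono r \<and> l \<in> param_mfd \<and> (\<lambda>i. z (r i) \<omega>) \<longlonglongrightarrow> l"
    if \<omega>: "\<omega> \<in> space M" for \<omega>
  proof -
    obtain l r where "l \<in> K\<^sub>1" "strict_mono r" "((\<lambda>t. z t \<omega>) \<circ> r) \<longlonglongrightarrow> l"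
      using K_compact inK[OF \<omega>] unfolding compact_def by metis
    then show ?thesis
      unfolding o_def using K_sub by blast
  qed

  obtain r where "\<forall>p\<in>K\<^sub>1. norm p \<le> r"
    using compact_imp_bounded[OF K_compact] unfolding bounded_iff by blast
  then have r: "K\<^sub>1 \<subseteq> cball 0 r"
    by (simp add: subset_iff)
  have v_lip: "lipschitz_on_balls (v s)" for s
    unfolding v_def by (intro lipschitz_on_balls_proj_mfd lipschitz_on_balls_ext_grad)
  have "\<exists>B. \<forall>p\<in>cball 0 r. norm (v s p) \<le> B" for s
    using lipschitz_on_balls_bounded[OF v_lip] by metis
  then obtain Bs where Bs: "\<And>s p. p \<in> cball 0 r \<Longrightarrow> norm (v s p) \<le> Bs s"
    by metis
  define B where "B = Max (range Bs)"
  have B: "norm (v s p) \<le> B" if "p \<in> K\<^sub>1" for s p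
  proof -
    have "norm (v s p) \<le> Bs s"
      using Bs r that by blast
    also have "\<dots> \<le> B"
      unfolding B_def by (rule Max_ge) auto
    finally show ?thesis .
  qed
  have z0K: "z\<^sub>0 \<in> K\<^sub>1"
    using z0 by (auto simp: K1 rho1 param_mfd_def)
  have B0: "0 \<le> B"
    using order_trans[OF norm_ge_zero B[OF z0K]] .
  have step_norm: "norm (- h *\<^sub>R v s p) = h * norm (v s p)" "norm (- h *\<^sub>R v s p) \<le> \<kappa> * B"
    if "p \<in> K\<^sub>1" "0 < h" "h \<le> \<kappa>" for p s h
    using that B[of p s] kappa(1) by (auto intro!: mult_mono)
  obtain C where C: "0 \<le> C" "\<And>p w. \<lbrakk>p \<in> param_mfd; w \<in> mfd_tangent p; norm w \<le> \<kappa> * B;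
      p \<in> cball 0 r; retract p w \<in> cball 0 r\<rbrakk> \<Longrightarrow> f (retract p w) \<le> f p + F p \<bullet> w + C * (norm w)\<^sup>2"
    using retract_descent[OF f_deriv F_lip, of "\<kappa> * B" r] kappa(1) B0 by auto
  obtain N where N: "0 \<le> N" "\<And>p q. p \<in> cball 0 r \<Longrightarrow> q \<in> cball 0 r \<Longrightarrow> norm (D p - D q) \<le> N * norm (p - q)"
    using lipschitz_on_ballsD[OF D_lip] by metis
  \<comment> \<open>Lipschitz constant of \<open>D\<close> times the factor in
    \<open>norm_retract_diff_le\<close> for tangent vectors of norm at most \<kappa> B.\<close>
  define L where "L = N * (1 + 2 * (real CARD('k))\<^sup>2 * (\<kappa> * B))"

  have conv: "AE \<omega> in M. (\<lambda>t. norm (D (z t \<omega>))) \<longlonglongrightarrow> 0"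
  proof (rule adaptive_sgd_gradient_tendsto_zero[where v = v and D = D and z = z and R = retract and K = K\<^sub>1 and B = B
        and f = f and C = C and L = L and \<eta> = \<eta> and \<alpha> = \<alpha> and \<beta> = \<beta> and \<epsilon> = \<epsilon> and \<xi> = \<xi>
        and w = "\<lambda>s. W $ fst s $ snd s" and z\<^sub>0 = z\<^sub>0])
    show "indep_vars (\<lambda>_. count_space UNIV) \<xi> UNIV" by (rule indep)
    show "prob {\<omega> \<in> space M. \<xi> t \<omega> = s} = W $ fst s $ snd s" for t s
      using distr[of t "fst s" "snd s"] by simp
    show "D p = (\<Sum>s\<in>UNIV. W $ fst s $ snd s *\<^sub>R v s p)" for p
      by (rule D_def)
    show "\<eta> t \<omega> = \<alpha> / (\<beta> + (\<Sum>s<t. (norm (v (\<xi> s \<omega>) (z s \<omega>)))\<^sup>2)) powr (1 / 2 + \<epsilon>)"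
      if "\<omega> \<in> space M" for t \<omega>
      using inK[OF that] K_sub by (simp add: eta[OF that] grad_g subsetD)
    show "z (Suc t) \<omega> = retract (z t \<omega>) (- \<eta> t \<omega> *\<^sub>R v (\<xi> t \<omega>) (z t \<omega>))"
      if "\<omega> \<in> space M" for t \<omega>
      using inK[OF that] K_sub by (simp add: step[OF that] grad_g subsetD)
    show "0 \<le> f p" for p
      unfolding f_def ext_g_def using W_nonneg lam_pos
      by (intro sum_nonneg mult_nonneg_nonneg add_nonneg_nonneg) auto
    fix s p h
    assume p: "p \<in> K\<^sub>1" and h: "0 < h" "h \<le> \<alpha> / \<beta> powr (1 / 2 + \<epsilon>)"
      and q: "retract p (- h *\<^sub>R v s p) \<in> K\<^sub>1"
    have h': "h \<le> \<kappa>"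
      using h(2) E_eq by (simp add: E_def)
    have pM: "p \<in> param_mfd" using p K_sub by blast
    have tan: "- h *\<^sub>R v s p \<in> mfd_tangent p"
      by (intro mfd_tangent_scaleR v_tangent pM)
    have "f (retract p (- h *\<^sub>R v s p))
        \<le> f p + F p \<bullet> (- h *\<^sub>R v s p) + C * (norm (- h *\<^sub>R v s p))\<^sup>2"
      using p q r by (intro C pM tan step_norm h h') auto
    \<comment> \<open>The sampled gradient is tangent, so the Euclidean gradient may be replaced by
      its projection.\<close>
    moreover have "F p \<bullet> v s p = D p \<bullet> v s p"
      unfolding D_proj by (rule inner_proj_mfd[OF v_tangent[OF pM], symmetric])
    ultimately show "f (retract p (- h *\<^sub>R v s p)) \<le> f p - h * (D p \<bullet> v s p) + C * (h * norm (v s p))\<^sup>2"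
      unfolding step_norm(1)[OF p h(1) h'] by simp
    have "\<bar>norm (D (retract p (- h *\<^sub>R v s p))) - norm (D p)\<bar>
        \<le> norm (D (retract p (- h *\<^sub>R v s p)) - D p)"
      by (rule norm_triangle_ineq3)
    also have "\<dots> \<le> N * norm (retract p (- h *\<^sub>R v s p) - p)"
      using p q r by (intro N) auto
    also have "\<dots> \<le> N * ((1 + 2 * (real CARD('k))\<^sup>2 * (\<kappa> * B)) * norm (- h *\<^sub>R v s p))"
      by (intro mult_left_mono N norm_retract_diff_le pM tan step_norm p h h')
    finally show "\<bar>norm (D (retract p (- h *\<^sub>R v s p))) - norm (D p)\<bar> \<le> L * (h * norm (v s p))"
      unfolding step_norm(1)[OF p h(1) h'] by (simp add: L_def mult.assoc)
  qed (use alpha beta_pos eps init inK B C in auto)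

  have conv_G: "AE \<omega> in M. (\<lambda>t. norm (riemannian_gradient param_mfd (obj_G A W lam) (z t \<omega>))) \<longlonglongrightarrow> 0"
    using conv
  proof (rule AE_mp, intro AE_I2 impI)
    fix \<omega> assume \<omega>: "\<omega> \<in> space M" and "(\<lambda>t. norm (D (z t \<omega>))) \<longlonglongrightarrow> 0"
    then show "(\<lambda>t. norm (riemannian_gradient param_mfd (obj_G A W lam) (z t \<omega>))) \<longlonglongrightarrow> 0"
      using inK[OF \<omega>] K_sub by (simp add: grad_G subsetD)
  qed
  have limits: "AE \<omega> in M. \<forall>l. (\<exists>r. strict_mono r \<and> (\<lambda>i. z (r i) \<omega>) \<longlonglongrightarrow> l) \<longrightarrow>
      stationary_point param_mfd (obj_G A W lam) l"
    using conv
  proof (rule AE_mp, intro AE_I2 impI allI)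
    fix \<omega> l assume \<omega>: "\<omega> \<in> space M" and lim: "(\<lambda>t. norm (D (z t \<omega>))) \<longlonglongrightarrow> 0"
      and "\<exists>r. strict_mono r \<and> (\<lambda>i. z (r i) \<omega>) \<longlonglongrightarrow> l"
    then obtain \<sigma> where \<sigma>: "strict_mono \<sigma>" "(\<lambda>i. z (\<sigma> i) \<omega>) \<longlonglongrightarrow> l" by blast
    have "l \<in> K\<^sub>1"
      using closed_sequentially[OF compact_imp_closed[OF K_compact] _ \<sigma>(2)] inK[OF \<omega>] by blast
    then have l: "l \<in> param_mfd" using K_sub by blast
    \<comment> \<open>\<open>D\<close> is continuous on the whole ambient space, so passing to the
      limit needs no statement about gradients near \<open>l\<close> in the manifold.\<close>
    have cont: "isCont D l"
      using lipschitz_on_balls_continuous[OF D_lip]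
      unfolding continuous_on_eq_continuous_at[OF open_UNIV] by blast
    have "(\<lambda>i. norm (D (z (\<sigma> i) \<omega>))) \<longlonglongrightarrow> norm (D l)"
      by (rule tendsto_norm[OF isCont_tendsto_compose[OF cont \<sigma>(2)]])
    moreover have "(\<lambda>i. norm (D (z (\<sigma> i) \<omega>))) \<longlonglongrightarrow> 0"
      using LIMSEQ_subseq_LIMSEQ[OF lim \<sigma>(1)] by (simp add: o_def)
    ultimately have "norm (D l) = 0"
      by (rule LIMSEQ_unique)
    then show "stationary_point param_mfd (obj_G A W lam) l"
      using l by (simp add: stationary_point_def grad_G)
  qed
  show ?thesis
    by (intro conjI ballI allI K_compact K_sub inK subseq conv_G limits)
qed

end
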